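(* Let $k\ge2$, let $A\in\mathbb{R}^{d_1\times\cdots\times d_k}$ be a fixed tensor, let $\delta=(\delta_1,\dots,\delta_k)\in(0,1]^k$, and let $\bar X=\frac1n\sum_{i=1}^nX_i$ with $X_i=(d_1\cdots d_k)\mathcal{P}_{\omega_i}A$, where $\omega_1,\dots,\omega_n$ are i.i.d. uniform on $[d_1]\times\cdots\times[d_k]$. Suppose that $d$ is sufficiently large such that $$\frac{8e}{9\log2}k^2(\log d)^3\le d.$$ Then for any $\alpha>0$ and any $$t\ge160(3\alpha+7)\frac kn\sqrt{d\log d_*}\,(2\delta_*d_* )^k\|A\|_{\max}\max_{1\le j_1<j_2\le k}\left\{\frac{n}{\delta_{j_1}^2d_{j_1}\delta_{j_2}^2d_{j_2}}+\frac{\log d}{\delta_{j_1}^2\delta_{j_2}^2}\right\}^{1/2},$$ one has $$\mathbb{P}\left\{\|\bar X-A\|_{\circ,\delta}\ge t\right\}\le\frac12k^2d^{-\alpha}+\frac{1}{4(\log2)^2}k^2(\log d)^2\left\{\exp\left(-\frac{9nt^2}{64k\,d_*^k\|A\|_{\max}^2\log d_*}\right)+\exp\left(-\frac{9nt}{32k\,\delta_*^k\delta_{**}^{-2}d_*^k\|A\|_{\max}\log d_*}\right)\right\}.$$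
   Context: $[m]=\{1,\dots,m\}$; $\log$ is the natural logarithm. For $\omega\in[d_1]\times\cdots\times[d_k]$, $\mathcal{P}_\omega A$ is the tensor agreeing with $A$ at entry $\omega$ and equal to $0$ elsewhere. $\|A\|_{\max}=\max_\omega|A(\omega)|$. Put $$d=\frac1k\sum_{j=1}^kd_j,\quad d_*=(d_1\cdots d_k)^{1/k},\quad\delta_*=(\delta_1\cdots\delta_k)^{1/k},\quad\delta_{**}=\min_{1\le j_1<j_2\le k}\sqrt{\delta_{j_1}\delta_{j_2}}.$$ With $\langle\cdot,\cdot\rangle$ the entrywise inner product, for $1\le j_1<j_2\le k$ let $$\mathscr{U}_{j_1j_2}(\delta)=\{u_1\otimes\cdots\otimes u_k:\ u_j\in\mathbb{R}^{d_j},\ \|u_j\|_{\ell_2}\le1\ \forall j;\ \|u_j\|_{\ell_\infty}\le\delta_j\ \forall j\ne j_1,j_2\},$$ $\mathscr{U}(\delta)=\bigcup_{1\le j_1<j_2\le k}\mathscr{U}_{j_1j_2}(\delta)$ and $\|X\|_{\circ,\delta}=\sup_{Y\in\mathscr{U}(\delta)}\langle Y,X\rangle$. *)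

theory Defs
  imports "HOL-Probability.Probability"
begin

text \<open>
  A tensor in \<open>\<real>\<close> of format \<open>d 1 \<times> \<dots> \<times> d k\<close> is a function on multi-indices \<open>nat \<Rightarrow> nat\<close>;
  only its values on \<open>tensor_index k d\<close> matter. Likewise, only the entries \<open>v 1, \<dots>, v m\<close>
  of a function \<open>v :: nat \<Rightarrow> real\<close> representing a vector in dimension \<open>m\<close> matter.
\<close>

definition tensor_index :: "nat \<Rightarrow> (nat \<Rightarrow> nat) \<Rightarrow> (nat \<Rightarrow> nat) set" where
  "tensor_index k d = (\<Pi>\<^sub>E j\<in>{1..k}. {1..d j})"

definition tensor_proj :: "(nat \<Rightarrow> nat) \<Rightarrow> ((nat \<Rightarrow> nat) \<Rightarrow> real) \<Rightarrow> (nat \<Rightarrow> nat) \<Rightarrow> real" where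
  "tensor_proj \<omega> A = (\<lambda>\<eta>. if \<eta> = \<omega> then A \<eta> else 0)"

definition tensor_max_norm :: "nat \<Rightarrow> (nat \<Rightarrow> nat) \<Rightarrow> ((nat \<Rightarrow> nat) \<Rightarrow> real) \<Rightarrow> real" where
  "tensor_max_norm k d A = Max ((\<lambda>\<omega>. \<bar>A \<omega>\<bar>) ` tensor_index k d)"

definition tensor_inner ::
  "nat \<Rightarrow> (nat \<Rightarrow> nat) \<Rightarrow> ((nat \<Rightarrow> nat) \<Rightarrow> real) \<Rightarrow> ((nat \<Rightarrow> nat) \<Rightarrow> real) \<Rightarrow> real" where
  "tensor_inner k d Y X = (\<Sum>\<omega>\<in>tensor_index k d. Y \<omega> * X \<omega>)"

definition rank_one_tensor :: "nat \<Rightarrow> (nat \<Rightarrow> nat \<Rightarrow> real) \<Rightarrow> (nat \<Rightarrow> nat) \<Rightarrow> real" where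
  "rank_one_tensor k u = (\<lambda>\<omega>. \<Prod>j=1..k. u j (\<omega> j))"

definition l2_norm :: "nat \<Rightarrow> (nat \<Rightarrow> real) \<Rightarrow> real" where
  "l2_norm m v = L2_set v {1..m}"

definition linf_norm :: "nat \<Rightarrow> (nat \<Rightarrow> real) \<Rightarrow> real" where
  "linf_norm m v = Max ((\<lambda>i. \<bar>v i\<bar>) ` {1..m})"

definition mode_pairs :: "nat \<Rightarrow> (nat \<times> nat) set" where
  "mode_pairs k = {(j1, j2). 1 \<le> j1 \<and> j1 < j2 \<and> j2 \<le> k}"

definition incoherent_pair_set ::
  "nat \<Rightarrow> (nat \<Rightarrow> nat) \<Rightarrow> (nat \<Rightarrow> real) \<Rightarrow> nat \<times> nat \<Rightarrow> ((nat \<Rightarrow> nat) \<Rightarrow> real) set" where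
  "incoherent_pair_set k d \<delta> = (\<lambda>(j1, j2).
     {rank_one_tensor k u | u.
        (\<forall>j\<in>{1..k}. l2_norm (d j) (u j) \<le> 1) \<and>
        (\<forall>j\<in>{1..k} - {j1, j2}. linf_norm (d j) (u j) \<le> \<delta> j)})"

definition incoherent_set ::
  "nat \<Rightarrow> (nat \<Rightarrow> nat) \<Rightarrow> (nat \<Rightarrow> real) \<Rightarrow> ((nat \<Rightarrow> nat) \<Rightarrow> real) set" where
  "incoherent_set k d \<delta> = (\<Union>p\<in>mode_pairs k. incoherent_pair_set k d \<delta> p)"

definition incoherent_norm ::
  "nat \<Rightarrow> (nat \<Rightarrow> nat) \<Rightarrow> (nat \<Rightarrow> real) \<Rightarrow> ((nat \<Rightarrow> nat) \<Rightarrow> real) \<Rightarrow> real" where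
  "incoherent_norm k d \<delta> X = (SUP Y\<in>incoherent_set k d \<delta>. tensor_inner k d Y X)"

definition arith_mean :: "nat \<Rightarrow> (nat \<Rightarrow> real) \<Rightarrow> real" where
  "arith_mean k a = (1 / real k) * (\<Sum>j=1..k. a j)"

definition geom_mean :: "nat \<Rightarrow> (nat \<Rightarrow> real) \<Rightarrow> real" where
  "geom_mean k a = root k (\<Prod>j=1..k. a j)"

definition min_pair_geom_mean :: "nat \<Rightarrow> (nat \<Rightarrow> real) \<Rightarrow> real" where
  "min_pair_geom_mean k a = Min ((\<lambda>(j1, j2). sqrt (a j1 * a j2)) ` mode_pairs k)"

definition sampled_tensor ::
  "nat \<Rightarrow> (nat \<Rightarrow> nat) \<Rightarrow> ((nat \<Rightarrow> nat) \<Rightarrow> real) \<Rightarrow> (nat \<Rightarrow> nat) \<Rightarrow> (nat \<Rightarrow> nat) \<Rightarrow> real" where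
  "sampled_tensor k d A \<omega> = (\<lambda>\<eta>. (\<Prod>j=1..k. real (d j)) * tensor_proj \<omega> A \<eta>)"

definition sample_mean ::
  "nat \<Rightarrow> (nat \<Rightarrow> (nat \<Rightarrow> nat) \<Rightarrow> real) \<Rightarrow> (nat \<Rightarrow> nat) \<Rightarrow> real" where
  "sample_mean n X = (\<lambda>\<eta>. (1 / real n) * (\<Sum>i=1..n. X i \<eta>))"

definition iid_uniform ::
  "'w measure \<Rightarrow> 'b set \<Rightarrow> nat \<Rightarrow> (nat \<Rightarrow> 'w \<Rightarrow> 'b) \<Rightarrow> bool" where
  "iid_uniform M I n \<omega> \<longleftrightarrow>
     prob_space.indep_vars M (\<lambda>_. count_space I) \<omega> {1..n} \<and>
     (\<forall>i\<in>{1..n}. distr M (count_space I) (\<omega> i) = uniform_count_measure I)"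

end

theory Submission
  imports Defs
begin

text \<open>
  Fix a pair \<open>j1 < j2\<close> of modes. By multilinearity the vectors in the other modes may be taken to be
  vertices of the cube \<open>{- \<delta> j, \<delta> j}\<close>, and those in modes \<open>j1\<close>, \<open>j2\<close> to lie on a grid in the
  Euclidean ball, at the cost of a factor \<open>16/9\<close>; this leaves \<open>exp (O (\<Sum>j. d j))\<close> rank-one tensors.
  Split the index set into the cells with prescribed coordinates \<open>j1\<close>, \<open>j2\<close>. For a fixed tensor of the
  net, its squared values depend, up to constants, only on the cell and add up to at most 1 over the cells,
  so if no cell contains more than \<open>\<nu>\<close> samples then the sum of squares over the whole sample is at most
  \<open>\<nu>\<close>. Randomly swapping the sample with an independent copy therefore gives a subgaussian tail with
  variance proxy \<open>O (\<nu>)\<close>, which beats the cardinality of the net for \<open>\<nu>\<close> of order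
  \<open>n / (d j1 * d j2) + ln dm\<close>, and by Chernoff's bound no cell is that full except with probability of
  order \<open>dm powr (- \<alpha>)\<close>. As the samples are uniform on a finite set, all probabilities are computed by counting.
\<close>

section \<open>Tail bounds by counting\<close>

lemma exp_le_quadratic:
  fixes x :: real
  assumes "\<bar>x\<bar> \<le> 1"
  shows "exp x \<le> 1 + x + x\<^sup>2"
proof (cases "x \<ge> 0")
  case True
  then show ?thesis using exp_bound[of x] assms by simp
next
  case False
  define y where "y = - x"
  have y: "0 < y" "y \<le> 1" using False assms by (auto simp: y_def)
  have "exp x = 1 / exp y" by (simp add: y_def exp_minus field_simps)
  also have "\<dots> \<le> 1 / (1 + y)" using y by (intro divide_left_mono) (auto simp: exp_ge_add_one_self)
  also have "\<dots> \<le> 1 - y + y\<^sup>2"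
  proof -
    have "(1 - y + y\<^sup>2) * (1 + y) = 1 + y ^ 3" by (simp add: algebra_simps power2_eq_square power3_eq_cube)
    then show ?thesis using y by (simp add: pos_divide_le_eq)
  qed
  finally show ?thesis by (simp add: y_def)
qed

text \<open>Hoeffding's lemma for a fair coin with values \<open>- x\<close> and \<open>x\<close>,
  in other words \<open>cosh x \<le> exp (x^2 / 2)\<close>. Both sides are even in \<open>x\<close>,
  so nonnegative arguments suffice.\<close>

lemma exp_add_exp_minus_le:
  fixes x :: real
  shows "exp x + exp (- x) \<le> 2 * exp (x\<^sup>2 / 2)"
proof -
  have *: "exp y + exp (- y) \<le> 2 * exp (y\<^sup>2 / 2)" if "y \<ge> 0" for y :: real
  proof -
    \<comment> \<open>With weight \<open>1/2\<close> and a range of length \<open>2 * y\<close> the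
      left-hand side is \<open>ln (cosh y)\<close>.\<close>
    have "- (2 * y) * (1/2) + ln (1 + (1/2) * (exp (2 * y) - 1)) \<le> (2 * y)\<^sup>2 / 8"
      by (rule Hoeffdings_lemma_aux) (use that in auto)
    then have "ln (1 + (1/2) * (exp (2 * y) - 1)) \<le> y + y\<^sup>2 / 2"
      by (simp add: power2_eq_square)
    moreover have pos: "1 + (1/2) * (exp (2 * y) - 1) > 0"
      by (simp add: field_simps add_pos_pos)
    ultimately have "1 + (1/2) * (exp (2 * y) - 1) \<le> exp (y + y\<^sup>2 / 2)"
      by (metis exp_le_cancel_iff exp_ln)
    then have "exp (- y) * (1 + (1/2) * (exp (2 * y) - 1)) \<le> exp (- y) * exp (y + y\<^sup>2 / 2)"
      by (intro mult_left_mono) auto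
    moreover have "exp (- y) * exp (2 * y) = exp y" "exp (- y) * exp (y + y\<^sup>2 / 2) = exp (y\<^sup>2 / 2)"
      by (simp_all flip: exp_add)
    ultimately show ?thesis by (simp add: algebra_simps)
  qed
  show ?thesis using *[of x] *[of "- x"] by (cases "x \<ge> 0") auto
qed

section \<open>Markov and Chernoff bounds for uniform samples, in counting form\<close>

lemma card_Collect_le_sum:
  fixes h :: "'b \<Rightarrow> real"
  assumes "finite S" "\<And>w. w \<in> S \<Longrightarrow> 0 \<le> h w" "\<And>w. w \<in> S \<Longrightarrow> P w \<Longrightarrow> 1 \<le> h w"
  shows "real (card {w\<in>S. P w}) \<le> sum h S"
proof -
  have "real (card {w\<in>S. P w}) = (\<Sum>w\<in>{w\<in>S. P w}. 1)" by simp
  also have "\<dots> \<le> (\<Sum>w\<in>{w\<in>S. P w}. h w)" by (intro sum_mono) (use assms in auto)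
  also have "\<dots> \<le> sum h S" by (intro sum_mono2) (use assms in auto)
  finally show ?thesis .
qed

text \<open>Independence of the coordinates of a uniform tuple: the exponential moment of a sum
  factorises.\<close>

lemma sum_PiE_exp:
  fixes g :: "'b \<Rightarrow> real"
  assumes "finite J" "finite I"
  shows "(\<Sum>w\<in>J \<rightarrow>\<^sub>E I. exp (\<Sum>i\<in>J. g (w i))) = (\<Sum>v\<in>I. exp (g v)) ^ card J"
proof -
  have "(\<Sum>w\<in>J \<rightarrow>\<^sub>E I. exp (\<Sum>i\<in>J. g (w i))) = (\<Sum>w\<in>J \<rightarrow>\<^sub>E I. \<Prod>i\<in>J. exp (g (w i)))"
    using assms by (simp add: exp_sum)
  also have "\<dots> = (\<Prod>i\<in>J. \<Sum>v\<in>I. exp (g v))"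
    using prod_sum_PiE[of J "\<lambda>_. I" "\<lambda>i v. exp (g v)"] assms by simp
  finally show ?thesis by simp
qed

lemma sum_exp_le:
  fixes h g :: "'b \<Rightarrow> real" and c :: real
  assumes "finite I" "I \<noteq> {}" "\<And>v. v \<in> I \<Longrightarrow> exp (h v) \<le> 1 + g v" "sum g I \<le> c * card I"
  shows "(\<Sum>v\<in>I. exp (h v)) \<le> card I * exp c"
proof -
  have "(\<Sum>v\<in>I. exp (h v)) \<le> (\<Sum>v\<in>I. 1 + g v)" using assms by (intro sum_mono)
  also have "\<dots> = card I + sum g I" by (simp add: sum.distrib)
  also have "\<dots> \<le> card I * (1 + c)" using assms by (simp add: algebra_simps)
  also have "\<dots> \<le> card I * exp c" by (intro mult_left_mono) (auto simp: exp_ge_add_one_self)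
  finally show ?thesis .
qed

text \<open>Chernoff's bound with exponential parameter 1. A coordinate lies in \<open>E\<close>
  with probability \<open>card E / card I\<close>; the factor 2 in front of the expected count comes
  from \<open>exp 1 \<le> 3 = 1 + 2\<close>.\<close>

lemma count_tail_bound:
  fixes \<nu> :: real
  assumes "finite J" "finite I" "I \<noteq> {}" "E \<subseteq> I"
  shows "real (card {w \<in> J \<rightarrow>\<^sub>E I. \<nu> \<le> card {i\<in>J. w i \<in> E}})
           \<le> card I ^ card J * exp (2 * card J * card E / card I - \<nu>)"
proof -
  let ?S = "J \<rightarrow>\<^sub>E I"
  have fin: "finite ?S" using assms by (intro finite_PiE)
  have cnt: "real (card {i\<in>J. w i \<in> E}) = (\<Sum>i\<in>J. indicator E (w i))" for w :: "'a \<Rightarrow> 'b"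
    using assms by (simp add: indicator_def sum.If_cases Int_def)
  have "real (card {w \<in> ?S. \<nu> \<le> card {i\<in>J. w i \<in> E}})
        \<le> (\<Sum>w\<in>?S. exp ((\<Sum>i\<in>J. indicator E (w i)) - \<nu>))"
    by (intro card_Collect_le_sum fin) (auto simp: cnt)
  also have "\<dots> = exp (- \<nu>) * (\<Sum>v\<in>I. exp (indicator E v)) ^ card J"
    by (subst sum_PiE_exp[OF assms(1,2), symmetric])
      (simp add: sum_distrib_left exp_diff exp_minus field_simps)
  also have "\<dots> \<le> exp (- \<nu>) * (card I * exp (2 * card E / card I)) ^ card J"
  proof (intro mult_left_mono power_mono)
    have c: "(2 * card E / card I) * card I = 2 * real (card E)" using assms by simp
    have s: "(\<Sum>v\<in>I. 2 * indicator E v) = 2 * real (card E)"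
      using assms by (simp add: indicator_def sum.If_cases Int_absorb1 flip: sum_distrib_left)
    show "(\<Sum>v\<in>I. exp (indicator E v)) \<le> card I * exp (2 * card E / card I)"
      by (rule sum_exp_le[where g = "\<lambda>v. 2 * indicator E v"])
        (use assms exp_le c s in \<open>auto simp: indicator_def\<close>)
  qed (auto intro: sum_nonneg)
  also have "\<dots> = card I ^ card J * exp (2 * card J * card E / card I - \<nu>)"
    by (simp add: power_mult_distrib exp_diff exp_minus field_simps flip: exp_of_nat_mult)
  finally show ?thesis by simp
qed

text \<open>Chernoff's bound with parameter \<open>l = 2 / \<tau>\<close>: the second moment
  contributes at most 1 to the exponent, the threshold contributes
  \<open>- l * \<tau> = - 2\<close>, and \<open>exp (- 1) \<le> 1 / 2\<close>. It serves to show
  that an independent copy often stays below its mean plus \<open>\<tau>\<close>.\<close>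

lemma deviation_le_half:
  fixes f :: "'b \<Rightarrow> real"
  assumes "finite J" "finite I" "I \<noteq> {}" and f: "\<And>v. v \<in> I \<Longrightarrow> \<bar>f v\<bar> \<le> 1"
    and \<tau>: "2 \<le> \<tau>" "4 * card J * (\<Sum>v\<in>I. (f v)\<^sup>2) / card I \<le> \<tau>\<^sup>2"
  shows "real (card {w \<in> J \<rightarrow>\<^sub>E I. card J * (sum f I / card I) + \<tau> \<le> (\<Sum>i\<in>J. f (w i))})
           \<le> card I ^ card J / 2"
proof -
  let ?S = "J \<rightarrow>\<^sub>E I"
  define m where "m = sum f I / card I"
  define s where "s = (\<Sum>v\<in>I. (f v)\<^sup>2) / card I"
  define l where "l = 2 / \<tau>"
  have fin: "finite ?S" using assms by (intro finite_PiE)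
  have l: "0 < l" "l \<le> 1" "l * \<tau> = 2" using \<tau> by (auto simp: l_def)
  have cI: "real (card I) > 0" using assms by (simp add: card_gt_0_iff)
  have "real (card {w \<in> ?S. card J * m + \<tau> \<le> (\<Sum>i\<in>J. f (w i))})
        \<le> (\<Sum>w\<in>?S. exp ((\<Sum>i\<in>J. l * f (w i)) - (card J * (l * m) + 2)))"
  proof (intro card_Collect_le_sum fin)
    fix w assume "card J * m + \<tau> \<le> (\<Sum>i\<in>J. f (w i))"
    then have "l * (card J * m + \<tau>) \<le> l * (\<Sum>i\<in>J. f (w i))" using l by simp
    then show "1 \<le> exp ((\<Sum>i\<in>J. l * f (w i)) - (card J * (l * m) + 2))"
      using l by (simp add: sum_distrib_left algebra_simps)
  qed auto
  also have "\<dots> = exp (- (card J * (l * m) + 2)) * (\<Sum>v\<in>I. exp (l * f v)) ^ card J"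
    by (subst sum_PiE_exp[OF assms(1,2), symmetric])
      (simp add: sum_distrib_left exp_diff exp_minus exp_add field_simps)
  also have "\<dots> \<le> exp (- (card J * (l * m) + 2)) * (card I * exp (l * m + l\<^sup>2 * s)) ^ card J"
  proof (intro mult_left_mono power_mono)
    show "(\<Sum>v\<in>I. exp (l * f v)) \<le> card I * exp (l * m + l\<^sup>2 * s)"
    proof (rule sum_exp_le[where g = "\<lambda>v. l * f v + (l * f v)\<^sup>2"])
      fix v assume "v \<in> I"
      \<comment> \<open>\<open>2 \<le> \<tau>\<close> gives \<open>l \<le> 1\<close>, which keeps
        the argument in the range of the quadratic bound for \<open>exp\<close>.\<close>
      then have "\<bar>l * f v\<bar> \<le> 1" using f l by (simp add: abs_mult mult_le_one)
      then show "exp (l * f v) \<le> 1 + (l * f v + (l * f v)\<^sup>2)"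
        using exp_le_quadratic by fastforce
    next
      show "(\<Sum>v\<in>I. l * f v + (l * f v)\<^sup>2) \<le> (l * m + l\<^sup>2 * s) * card I"
        using cI by (simp add: m_def s_def sum.distrib power_mult_distrib algebra_simps flip: sum_distrib_left)
    qed (use assms in auto)
  qed (auto intro: sum_nonneg)
  also have "\<dots> = card I ^ card J * exp (card J * l\<^sup>2 * s - 2)"
    by (simp add: power_mult_distrib exp_diff exp_minus exp_add field_simps flip: exp_of_nat_mult)
  also have "\<dots> \<le> card I ^ card J * exp (- 1)"
  proof -
    have "4 * card J * s \<le> \<tau>\<^sup>2" using \<tau>(2) by (simp add: s_def field_simps)
    then have "card J * l\<^sup>2 * s \<le> 1"
      using \<tau> by (simp add: l_def power2_eq_square field_simps)
    then show ?thesis by (intro mult_left_mono) auto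
  qed
  also have "\<dots> \<le> card I ^ card J / 2"
  proof -
    have "exp (1::real) \<ge> 2" using exp_ge_add_one_self[of 1] by simp
    then have "exp (- 1 :: real) \<le> 1 / 2" by (simp add: exp_minus field_simps)
    then show ?thesis using cI by (simp add: field_simps)
  qed
  finally show ?thesis unfolding m_def .
qed

section \<open>Symmetrization by swapping coordinates with an independent copy\<close>

lemma sum_swap_coordinates:
  fixes h :: "('a \<Rightarrow> 'b) \<Rightarrow> ('a \<Rightarrow> 'b) \<Rightarrow> real"
  fixes I :: "'b set"
  assumes "B \<subseteq> J"
  defines "S \<equiv> J \<rightarrow>\<^sub>E I"
  shows "(\<Sum>(w, w')\<in>S \<times> S. h (override_on w w' B) (override_on w' w B)) = (\<Sum>(w, w')\<in>S \<times> S. h w w')"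
proof (rule sum.reindex_bij_witness)
  \<comment> \<open>The swap is an involution on pairs of samples, so it is its own inverse in the
    reindexing.\<close>
  let ?sw = "\<lambda>(w, w'). (override_on w w' B, override_on w' w B)"
  have mem: "override_on w w' B \<in> S" if "w \<in> S" "w' \<in> S" for w w'
    using that assms(1) unfolding S_def override_on_def by (auto simp: PiE_iff extensional_def)
  show "?sw p \<in> S \<times> S" if "p \<in> S \<times> S" for p using that mem by auto
  show "?sw p \<in> S \<times> S" if "p \<in> S \<times> S" for p using that mem by auto
qed (auto simp: override_on_def fun_eq_iff)

text \<open>The exponential moment on the event \<open>G\<close> is averaged over all swap sets
  \<open>B\<close>. As \<open>G\<close> is invariant, this puts independent random signs on the
  differences \<open>f (w i) - f (w' i)\<close>, and each sign costs \<open>exp (x^2 / 2)\<close>.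
  The sum of squares is needed only on \<open>G\<close>, where it is at most
  \<open>V\<close>.\<close>

lemma symmetrized_tail_bound:
  fixes f :: "'b \<Rightarrow> real" and G :: "('a \<Rightarrow> 'b) \<Rightarrow> ('a \<Rightarrow> 'b) \<Rightarrow> bool"
  assumes "finite J" "finite I"
    and G: "\<And>w w' B. B \<subseteq> J \<Longrightarrow> G (override_on w w' B) (override_on w' w B) = G w w'"
    and V: "V > 0" "\<And>w w'. w \<in> J \<rightarrow>\<^sub>E I \<Longrightarrow> w' \<in> J \<rightarrow>\<^sub>E I \<Longrightarrow> G w w' \<Longrightarrow>
      (\<Sum>i\<in>J. (f (w i) - f (w' i))\<^sup>2) \<le> V"
    and \<tau>: "\<tau> > 0"
  shows "real (card {(w, w') \<in> (J \<rightarrow>\<^sub>E I) \<times> (J \<rightarrow>\<^sub>E I).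
             G w w' \<and> \<tau> \<le> (\<Sum>i\<in>J. f (w i) - f (w' i))})
           \<le> (card I ^ card J)\<^sup>2 * exp (- \<tau>\<^sup>2 / (2 * V))"
proof -
  let ?S = "J \<rightarrow>\<^sub>E I"
  \<comment> \<open>This is the minimiser of the final exponent
    \<open>l^2 * V / 2 - l * \<tau>\<close>.\<close>
  define l where "l = \<tau> / V"
  define E where "E = (\<lambda>w w'. of_bool (G w w') * exp (l * (\<Sum>i\<in>J. f (w i) - f (w' i))))"
  have fin: "finite (?S \<times> ?S)" using assms by (auto intro: finite_PiE)
  have l: "l > 0" using assms by (simp add: l_def)
  let ?P = "\<lambda>p. case p of (w, w') \<Rightarrow> G w w' \<and> \<tau> \<le> (\<Sum>i\<in>J. f (w i) - f (w' i))"
  have set_eq: "{(w, w') \<in> ?S \<times> ?S. G w w' \<and> \<tau> \<le> (\<Sum>i\<in>J. f (w i) - f (w' i))} = {p \<in> ?S \<times> ?S. ?P p}"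
    by auto
  have 1: "real (card {p \<in> ?S \<times> ?S. ?P p}) \<le> (\<Sum>p\<in>?S \<times> ?S. case p of (w, w') \<Rightarrow> exp (- (l * \<tau>)) * E w w')"
  proof (intro card_Collect_le_sum fin)
    fix p assume "?P p"
    moreover obtain w w' where [simp]: "p = (w, w')" by (cases p)
    ultimately have "G w w'" "l * \<tau> \<le> l * (\<Sum>i\<in>J. f (w i) - f (w' i))" using l by auto
    then show "1 \<le> (case p of (w, w') \<Rightarrow> exp (- (l * \<tau>)) * E w w')"
      by (simp add: E_def flip: exp_add)
  qed (auto simp: E_def)
  \<comment> \<open>Swapping on \<open>B\<close> reverses the sign of the differences with index in
    \<open>B\<close> and leaves the total sum unchanged.\<close>
  have swap: "(\<Sum>(w, w')\<in>?S \<times> ?S. E w w') = (\<Sum>(w, w')\<in>?S \<times> ?S. of_bool (G w w') *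
      ((\<Prod>i\<in>B. exp (- (l * (f (w i) - f (w' i))))) * (\<Prod>i\<in>J - B. exp (l * (f (w i) - f (w' i))))))"
    if B: "B \<subseteq> J" for B
  proof -
    have "(\<Sum>(w, w')\<in>?S \<times> ?S. E w w') = (\<Sum>(w, w')\<in>?S \<times> ?S. E (override_on w w' B) (override_on w' w B))"
      using sum_swap_coordinates[OF B] by metis
    also have "\<dots> = (\<Sum>(w, w')\<in>?S \<times> ?S. of_bool (G w w') *
      ((\<Prod>i\<in>B. exp (- (l * (f (w i) - f (w' i))))) * (\<Prod>i\<in>J - B. exp (l * (f (w i) - f (w' i))))))"
    proof (intro sum.cong refl, clarify)
      fix w w' assume "w \<in> ?S" "w' \<in> ?S"
      have fB: "finite B" using B assms(1) finite_subset by blast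
      have "(\<Sum>i\<in>J. f (override_on w w' B i) - f (override_on w' w B i))
          = (\<Sum>i\<in>B. - (f (w i) - f (w' i))) + (\<Sum>i\<in>J - B. f (w i) - f (w' i))"
        by (subst sum.subset_diff[OF B assms(1)]) (simp add: add.commute)
      then have "exp (l * (\<Sum>i\<in>J. f (override_on w w' B i) - f (override_on w' w B i))) =
         exp (\<Sum>i\<in>B. - (l * (f (w i) - f (w' i)))) * exp (\<Sum>i\<in>J - B. l * (f (w i) - f (w' i)))"
        by (simp only: ring_distribs sum_distrib_left exp_add mult_minus_right)
      then show "E (override_on w w' B) (override_on w' w B) = of_bool (G w w') *
      ((\<Prod>i\<in>B. exp (- (l * (f (w i) - f (w' i))))) * (\<Prod>i\<in>J - B. exp (l * (f (w i) - f (w' i)))))"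
        using fB assms(1) by (simp add: E_def G[OF B] exp_sum)
    qed
    finally show ?thesis .
  qed
  \<comment> \<open>Summation over all \<open>B\<close> turns the products over \<open>B\<close> and
    \<open>J - B\<close> into the expansion of a product of sums
    \<open>exp (- x) + exp x\<close>.\<close>
  have "2 ^ card J * (\<Sum>(w, w')\<in>?S \<times> ?S. E w w') = (\<Sum>B\<in>Pow J. \<Sum>(w, w')\<in>?S \<times> ?S. E w w')"
    using assms(1) by (simp add: card_Pow)
  also have "\<dots> = (\<Sum>B\<in>Pow J. \<Sum>(w, w')\<in>?S \<times> ?S. of_bool (G w w') *
      ((\<Prod>i\<in>B. exp (- (l * (f (w i) - f (w' i))))) * (\<Prod>i\<in>J - B. exp (l * (f (w i) - f (w' i))))))"
    by (intro sum.cong refl swap) auto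
  also have "\<dots> = (\<Sum>(w, w')\<in>?S \<times> ?S. of_bool (G w w') * (\<Sum>B\<in>Pow J.
      ((\<Prod>i\<in>B. exp (- (l * (f (w i) - f (w' i))))) * (\<Prod>i\<in>J - B. exp (l * (f (w i) - f (w' i)))))))"
    by (subst sum.swap) (simp add: sum_distrib_left case_prod_beta)
  also have "\<dots> = (\<Sum>(w, w')\<in>?S \<times> ?S. of_bool (G w w') *
      (\<Prod>i\<in>J. exp (- (l * (f (w i) - f (w' i)))) + exp (l * (f (w i) - f (w' i)))))"
    by (simp add: prod_add[OF assms(1)])
  also have "\<dots> \<le> (\<Sum>(w, w')\<in>?S \<times> ?S. 2 ^ card J * exp (l\<^sup>2 * V / 2))"
  proof (intro sum_mono, clarify)
    fix w w' assume w: "w \<in> ?S" "w' \<in> ?S"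
    show "of_bool (G w w') * (\<Prod>i\<in>J. exp (- (l * (f (w i) - f (w' i)))) + exp (l * (f (w i) - f (w' i))))
      \<le> 2 ^ card J * exp (l\<^sup>2 * V / 2)"
    proof (cases "G w w'")
      case True
      have "(\<Prod>i\<in>J. exp (- (l * (f (w i) - f (w' i)))) + exp (l * (f (w i) - f (w' i))))
         \<le> (\<Prod>i\<in>J. 2 * exp ((l * (f (w i) - f (w' i)))\<^sup>2 / 2))"
        using exp_add_exp_minus_le by (intro prod_mono) (auto simp: add.commute add_nonneg_nonneg)
      also have "\<dots> = 2 ^ card J * exp (\<Sum>i\<in>J. (l * (f (w i) - f (w' i)))\<^sup>2 / 2)"
        using assms(1) by (simp add: prod.distrib exp_sum)
      also have "(\<Sum>i\<in>J. (l * (f (w i) - f (w' i)))\<^sup>2 / 2) = l\<^sup>2 / 2 * (\<Sum>i\<in>J. (f (w i) - f (w' i))\<^sup>2)"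
        by (simp add: sum_distrib_left power_mult_distrib)
      also have "\<dots> \<le> l\<^sup>2 / 2 * V" by (intro mult_left_mono V(2) w True) auto
      finally show ?thesis using True by simp
    qed simp
  qed
  also have "\<dots> = 2 ^ card J * ((card I ^ card J)\<^sup>2 * exp (l\<^sup>2 * V / 2))"
    using assms by (simp add: card_PiE card_cartesian_product power2_eq_square)
  finally have E_le: "(\<Sum>(w, w')\<in>?S \<times> ?S. E w w') \<le> (card I ^ card J)\<^sup>2 * exp (l\<^sup>2 * V / 2)"
    by simp
  have "(\<Sum>p\<in>?S \<times> ?S. case p of (w, w') \<Rightarrow> exp (- (l * \<tau>)) * E w w') = exp (- (l * \<tau>)) * (\<Sum>(w, w')\<in>?S \<times> ?S. E w w')"
    by (simp add: sum_distrib_left case_prod_beta)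
  also have "\<dots> \<le> exp (- (l * \<tau>)) * ((card I ^ card J)\<^sup>2 * exp (l\<^sup>2 * V / 2))"
    using E_le by simp
  also have "\<dots> = (card I ^ card J)\<^sup>2 * exp (l\<^sup>2 * V / 2 - l * \<tau>)"
    by (simp add: mult_ac flip: exp_add)
  also have "l\<^sup>2 * V / 2 - l * \<tau> = - \<tau>\<^sup>2 / (2 * V)"
    using V(1) by (simp add: l_def power2_eq_square field_simps)
  finally show ?thesis using 1 unfolding set_eq by linarith
qed

section \<open>Deviations over uniform cells\<close>

lemma sum_comp_by_cell:
  fixes g :: "'c \<Rightarrow> real"
  assumes "finite A" "finite C" "\<pi> ` A \<subseteq> C"
  shows "(\<Sum>i\<in>A. g (\<pi> i)) = (\<Sum>c\<in>C. card {i\<in>A. \<pi> i = c} * g c)"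
proof -
  have "(\<Sum>i\<in>A. g (\<pi> i)) = (\<Sum>c\<in>C. \<Sum>i\<in>{i\<in>A. \<pi> i = c}. g (\<pi> i))"
    by (rule sum.group[symmetric]) (use assms in auto)
  also have "\<dots> = (\<Sum>c\<in>C. card {i\<in>A. \<pi> i = c} * g c)"
    by (intro sum.cong refl) simp
  finally show ?thesis .
qed

text \<open>A swapped coordinate only moves its contribution from one sample to the other. Joint
  counts over both samples are therefore swap-invariant, although the separate counts are
  not.\<close>

lemma card_swap_coordinates:
  assumes "finite J" "B \<subseteq> J"
  shows "card {i\<in>J. P (override_on w w' B i)} + card {i\<in>J. P (override_on w' w B i)}
       = card {i\<in>J. P (w i)} + card {i\<in>J. P (w' i)}"
proof -
  have *: "card {i\<in>J. Q i} = (\<Sum>i\<in>J. of_bool (Q i))" for Q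
    using assms(1) by (simp add: Int_def)
  show ?thesis unfolding * sum.distrib[symmetric]
    by (intro sum.cong refl) (auto simp: override_on_def)
qed

text \<open>The cells are the fibres of \<open>\<pi>\<close> over \<open>C\<close>. By
  \<open>card_cell\<close>, stated as a product to stay in the natural numbers, they have equal
  size, so a uniform element of \<open>I\<close> falls into each with probability
  \<open>1 / card C\<close>.\<close>

locale uniform_cells =
  fixes J :: "'a set" and I :: "'b set" and C :: "'c set" and \<pi> :: "'b \<Rightarrow> 'c"
  assumes finite_J: "finite J" and finite_I: "finite I" and I_ne: "I \<noteq> {}" and finite_C: "finite C"
    and \<pi>_mem: "\<pi> ` I \<subseteq> C"
    and card_cell: "c \<in> C \<Longrightarrow> card {v\<in>I. \<pi> v = c} * card C = card I"
begin

definition overfull :: "real \<Rightarrow> ('a \<Rightarrow> 'b) set" where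
  "overfull \<nu> = {w \<in> J \<rightarrow>\<^sub>E I. \<exists>c\<in>C. \<nu> \<le> card {i\<in>J. \<pi> (w i) = c}}"

lemma card_I_pos: "card I > 0" and card_C_pos: "card C > 0"
proof -
  show "card I > 0" using finite_I I_ne by (simp add: card_gt_0_iff)
  have "C \<noteq> {}" using \<pi>_mem I_ne by auto
  then show "card C > 0" using finite_C by (simp add: card_gt_0_iff)
qed

lemma finite_overfull: "finite (overfull \<nu>)"
  unfolding overfull_def using finite_J finite_I by (simp add: finite_PiE)

text \<open>Union bound over the cells; a single cell expects \<open>card J / card C\<close>
  samples, and \<open>count_tail_bound\<close> applies to it.\<close>

lemma card_overfull_le:
  "card (overfull \<nu>) \<le> card I ^ card J * (card C * exp (2 * card J / card C - \<nu>))"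
proof -
  have "card (overfull \<nu>) \<le> (\<Sum>c\<in>C. card {w \<in> J \<rightarrow>\<^sub>E I. \<nu> \<le> card {i\<in>J. \<pi> (w i) = c}})"
  proof -
    have "overfull \<nu> = (\<Union>c\<in>C. {w \<in> J \<rightarrow>\<^sub>E I. \<nu> \<le> card {i\<in>J. \<pi> (w i) = c}})"
      by (auto simp: overfull_def)
    then show ?thesis by (simp only: card_UN_le[OF finite_C])
  qed
  then have "real (card (overfull \<nu>)) \<le> (\<Sum>c\<in>C. real (card {w \<in> J \<rightarrow>\<^sub>E I. \<nu> \<le> card {i\<in>J. \<pi> (w i) = c}}))"
    by (simp only: of_nat_le_iff flip: of_nat_sum)
  also have "\<dots> \<le> (\<Sum>c\<in>C. card I ^ card J * exp (2 * card J / card C - \<nu>))"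
  proof (intro sum_mono)
    fix c assume c: "c \<in> C"
    let ?E = "{v\<in>I. \<pi> v = c}"
    have "{w \<in> J \<rightarrow>\<^sub>E I. \<nu> \<le> card {i\<in>J. \<pi> (w i) = c}} = {w \<in> J \<rightarrow>\<^sub>E I. \<nu> \<le> card {i\<in>J. w i \<in> ?E}}"
    proof (intro Collect_cong conj_cong refl)
      fix w assume "w \<in> J \<rightarrow>\<^sub>E I"
      then have "{i\<in>J. \<pi> (w i) = c} = {i\<in>J. w i \<in> ?E}" by auto
      then show "(\<nu> \<le> card {i\<in>J. \<pi> (w i) = c}) = (\<nu> \<le> card {i\<in>J. w i \<in> ?E})" by simp
    qed
    moreover have "real (card ?E) / card I = 1 / card C"
      using card_cell[OF c] card_I_pos card_C_pos by (simp add: field_simps flip: of_nat_mult)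
    then have "2 * card J * (real (card ?E) / card I) = 2 * card J * (1 / card C)"
      by (rule arg_cong)
    then have "2 * card J * card ?E / card I = 2 * card J / card C" by simp
    ultimately show "card {w \<in> J \<rightarrow>\<^sub>E I. \<nu> \<le> card {i\<in>J. \<pi> (w i) = c}} \<le> card I ^ card J * exp (2 * card J / card C - \<nu>)"
      using count_tail_bound[OF finite_J finite_I I_ne, of ?E \<nu>] by simp
  qed
  finally show ?thesis by (simp add: mult_ac)
qed

text \<open>
  The ghost sample \<open>w'\<close> is itself required to have no overfull cell, so that the pair of samples lies
  in an event that is invariant under swapping coordinates and controls the conditional variance.
\<close>

lemma deviation_off_overfull:
  fixes f :: "'b \<Rightarrow> real" and g :: "'c \<Rightarrow> real"
  assumes f: "\<And>v. v \<in> I \<Longrightarrow> (f v)\<^sup>2 \<le> g (\<pi> v)" and g: "\<And>c. c \<in> C \<Longrightarrow> 0 \<le> g c" "sum g C \<le> 1"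
    and \<nu>: "0 < \<nu>" and small: "4 * card (overfull \<nu>) \<le> card I ^ card J"
    and \<tau>: "2 \<le> \<tau>" "4 * card J / card C \<le> \<tau>\<^sup>2"
  shows "card {w \<in> J \<rightarrow>\<^sub>E I. w \<notin> overfull \<nu> \<and> card J * (sum f I / card I) + 2 * \<tau> \<le> (\<Sum>i\<in>J. f (w i))}
           \<le> card I ^ card J * (4 * exp (- \<tau>\<^sup>2 / (8 * \<nu>)))"
proof -
  let ?S = "J \<rightarrow>\<^sub>E I"
  define m where "m = sum f I / card I"
  define N where "N = real (card I ^ card J)"
  define D where "D = {w \<in> ?S. card J * m + \<tau> \<le> (\<Sum>i\<in>J. f (w i))}"
  define W where "W = {w \<in> ?S. w \<notin> overfull \<nu> \<and> card J * m + 2 * \<tau> \<le> (\<Sum>i\<in>J. f (w i))}"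
  define U where "U = ?S - D - overfull \<nu>"
  \<comment> \<open>Only the joint occupancy of a cell survives swapping, so the event is stated for
    it, with the bound \<open>2 * \<nu>\<close> that two samples without overfull cells
    satisfy.\<close>
  define G where "G = (\<lambda>w w'. \<forall>c\<in>C. real (card {i\<in>J. \<pi> (w i) = c} + card {i\<in>J. \<pi> (w' i) = c}) \<le> 2 * \<nu>)"
  have fin: "finite ?S" using finite_J finite_I by (intro finite_PiE)
  have card_S: "real (card ?S) = N" using finite_J by (simp add: card_PiE N_def)
  have N: "N > 0" using card_I_pos by (simp add: N_def)
  have f1: "\<bar>f v\<bar> \<le> 1" if "v \<in> I" for v
  proof -
    have "\<pi> v \<in> C" using \<pi>_mem that by auto
    then have "g (\<pi> v) \<le> sum g C" by (intro member_le_sum) (use g finite_C in auto)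
    then have "(f v)\<^sup>2 \<le> 1" using f[OF that] g by linarith
    then show ?thesis by (simp add: abs_square_le_1)
  qed
  have sum_sq: "(\<Sum>i\<in>J. (f (w i))\<^sup>2) \<le> (\<Sum>c\<in>C. card {i\<in>J. \<pi> (w i) = c} * g c)" if "w \<in> ?S" for w
  proof -
    have "(\<Sum>i\<in>J. (f (w i))\<^sup>2) \<le> (\<Sum>i\<in>J. g (\<pi> (w i)))" by (intro sum_mono f) (use that in auto)
    also have "\<dots> = (\<Sum>c\<in>C. card {i\<in>J. \<pi> (w i) = c} * g c)"
      using sum_comp_by_cell[OF finite_J finite_C, of "\<lambda>i. \<pi> (w i)" g] that \<pi>_mem by auto
    finally show ?thesis .
  qed
  \<comment> \<open>Equal cell sizes and total weight at most 1 bound the second moment of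
    \<open>f\<close> under the uniform distribution by \<open>1 / card C\<close>.\<close>
  have "(\<Sum>v\<in>I. (f v)\<^sup>2) \<le> (\<Sum>v\<in>I. g (\<pi> v))" by (intro sum_mono f)
  also have "\<dots> = (\<Sum>c\<in>C. card {v\<in>I. \<pi> v = c} * g c)"
    by (rule sum_comp_by_cell[OF finite_I finite_C \<pi>_mem])
  also have "\<dots> = (\<Sum>c\<in>C. card I / card C * g c)"
  proof (intro sum.cong refl)
    fix c assume "c \<in> C"
    then have "real (card {v\<in>I. \<pi> v = c}) = card I / card C"
      using card_cell card_C_pos by (simp add: field_simps flip: of_nat_mult)
    then show "card {v\<in>I. \<pi> v = c} * g c = card I / card C * g c" by simp
  qed
  also have "\<dots> = card I / card C * sum g C" by (rule sum_distrib_left[symmetric])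
  also have "\<dots> \<le> card I / card C" using g(2) by (intro mult_left_le) auto
  finally have var: "(\<Sum>v\<in>I. (f v)\<^sup>2) / card I \<le> 1 / card C"
    using card_I_pos card_C_pos by (simp add: field_simps)
  have D_half: "card D \<le> N / 2" unfolding D_def m_def N_def
  proof (rule order_trans[OF deviation_le_half[OF finite_J finite_I I_ne f1 \<tau>(1)]])
    have "4 * card J * ((\<Sum>v\<in>I. (f v)\<^sup>2) / card I) \<le> 4 * card J * (1 / card C)"
      by (intro mult_left_mono var) auto
    then show "4 * card J * (\<Sum>v\<in>I. (f v)\<^sup>2) / card I \<le> \<tau>\<^sup>2" using \<tau>(2) by simp
  qed auto
  have "?S \<subseteq> U \<union> D \<union> overfull \<nu>" by (auto simp: U_def)
  then have "card ?S \<le> card (U \<union> D \<union> overfull \<nu>)"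
    using fin by (intro card_mono) (auto simp: U_def D_def overfull_def)
  also have "\<dots> \<le> card U + card D + card (overfull \<nu>)"
    using card_Un_le[of "U \<union> D" "overfull \<nu>"] card_Un_le[of U D] by linarith
  finally have "N \<le> card U + card D + card (overfull \<nu>)" using card_S by linarith
  \<comment> \<open>At most half of the copies deviate by \<open>\<tau>\<close> and at most a
    quarter have an overfull cell, which leaves a quarter. Dividing by this fraction produces the
    factor 4 in the conclusion.\<close>
  then have U_quarter: "N / 4 \<le> card U"
  proof -
    have "real (4 * card (overfull \<nu>)) \<le> N" unfolding N_def using small by (simp only: of_nat_le_iff)
    then show ?thesis using D_half \<open>N \<le> card U + card D + card (overfull \<nu>)\<close> by simp
  qed
  \<comment> \<open>The sample exceeds the mean by \<open>2 * \<tau>\<close> and the copy by less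
    than \<open>\<tau>\<close>, so their difference is at least \<open>\<tau>\<close>.\<close>
  have "W \<times> U \<subseteq> {(w, w') \<in> ?S \<times> ?S. G w w' \<and> \<tau> \<le> (\<Sum>i\<in>J. f (w i) - f (w' i))}"
  proof (clarify, intro conjI)
    fix w w' assume w: "w \<in> W" "w' \<in> U"
    then show "(w, w') \<in> ?S \<times> ?S" by (auto simp: W_def U_def)
    show "G w w'" unfolding G_def
    proof
      fix c assume "c \<in> C"
      then have "real (card {i\<in>J. \<pi> (w i) = c}) < \<nu>" "real (card {i\<in>J. \<pi> (w' i) = c}) < \<nu>"
        using w by (auto simp: W_def U_def overfull_def not_le)
      then show "real (card {i\<in>J. \<pi> (w i) = c} + card {i\<in>J. \<pi> (w' i) = c}) \<le> 2 * \<nu>" by simp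
    qed
    show "\<tau> \<le> (\<Sum>i\<in>J. f (w i) - f (w' i))" using w by (auto simp: W_def U_def D_def sum_subtractf)
  qed
  then have "card (W \<times> U) \<le> card {(w, w') \<in> ?S \<times> ?S. G w w' \<and> \<tau> \<le> (\<Sum>i\<in>J. f (w i) - f (w' i))}"
    by (rule card_mono[rotated]) (rule finite_subset[of _ "?S \<times> ?S"], use fin in auto)
  also have "real \<dots> \<le> (card I ^ card J)\<^sup>2 * exp (- \<tau>\<^sup>2 / (2 * (4 * \<nu>)))"
  proof (rule symmetrized_tail_bound[OF finite_J finite_I])
    show "G (override_on w w' B) (override_on w' w B) = G w w'" if "B \<subseteq> J" for w w' B
      unfolding G_def card_swap_coordinates[OF finite_J that, of "\<lambda>v. \<pi> v = _"] ..
    show "(\<Sum>i\<in>J. (f (w i) - f (w' i))\<^sup>2) \<le> 4 * \<nu>" if w: "w \<in> ?S" "w' \<in> ?S" and G: "G w w'" for w w'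
    proof -
      have "(\<Sum>i\<in>J. (f (w i) - f (w' i))\<^sup>2) \<le> (\<Sum>i\<in>J. 2 * ((f (w i))\<^sup>2 + (f (w' i))\<^sup>2))"
      proof (intro sum_mono)
        fix i
        have "0 \<le> (f (w i) + f (w' i))\<^sup>2" by simp
        then show "(f (w i) - f (w' i))\<^sup>2 \<le> 2 * ((f (w i))\<^sup>2 + (f (w' i))\<^sup>2)"
          by (simp add: power2_eq_square algebra_simps)
      qed
      also have "\<dots> = 2 * ((\<Sum>i\<in>J. (f (w i))\<^sup>2) + (\<Sum>i\<in>J. (f (w' i))\<^sup>2))"
        by (simp add: sum_distrib_left sum.distrib)
      also have "\<dots> \<le> 2 * (\<Sum>c\<in>C. real (card {i\<in>J. \<pi> (w i) = c} + card {i\<in>J. \<pi> (w' i) = c}) * g c)"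
        using sum_sq[OF w(1)] sum_sq[OF w(2)] by (simp add: sum.distrib algebra_simps)
      also have "\<dots> \<le> 2 * (\<Sum>c\<in>C. 2 * \<nu> * g c)"
        by (intro mult_left_mono sum_mono mult_right_mono) (use G g in \<open>auto simp: G_def\<close>)
      also have "\<dots> = 2 * (2 * \<nu> * sum g C)" by (simp only: sum_distrib_left)
      also have "\<dots> \<le> 4 * \<nu>" using g(2) \<nu> by simp
      finally show ?thesis .
    qed
  qed (use \<nu> \<tau> in auto)
  finally have "real (card W) * card U \<le> N\<^sup>2 * exp (- \<tau>\<^sup>2 / (8 * \<nu>))"
    by (simp add: card_cartesian_product N_def)
  moreover have "real (card W) * (N / 4) \<le> real (card W) * card U"
    using U_quarter by (intro mult_left_mono) auto
  ultimately have "N * (real (card W) / 4) \<le> N * (N * exp (- \<tau>\<^sup>2 / (8 * \<nu>)))"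
    by (simp add: power2_eq_square mult_ac)
  then have "real (card W) / 4 \<le> N * exp (- \<tau>\<^sup>2 / (8 * \<nu>))" using N by simp
  then show ?thesis by (simp add: W_def m_def N_def)
qed

end

section \<open>Nets for multilinear forms\<close>

lemma sign_net:
  fixes c v :: "'a \<Rightarrow> real"
  assumes "\<And>i. i \<in> D \<Longrightarrow> \<bar>v i\<bar> \<le> r"
  shows "\<exists>z \<in> D \<rightarrow>\<^sub>E {- r, r}. (\<Sum>i\<in>D. v i * c i) \<le> (\<Sum>i\<in>D. z i * c i)"
proof (intro bexI sum_mono)
  \<comment> \<open>On the cube a linear functional is maximal at the vertex with the signs of its
    coefficients, so nothing is lost here.\<close>
  let ?z = "\<lambda>i\<in>D. if c i \<ge> 0 then r else - r"
  fix i assume i: "i \<in> D"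
  then have "v i * c i \<le> \<bar>v i\<bar> * \<bar>c i\<bar>" by (metis abs_ge_self abs_mult)
  also have "\<dots> \<le> r * \<bar>c i\<bar>" using assms[OF i] by (intro mult_right_mono) auto
  finally show "v i * c i \<le> ?z i * c i" using i by auto
qed auto

text \<open>Points of the unit ball on the grid of mesh \<open>1 / (4 * sqrt m)\<close>, where
  \<open>m = card D\<close>. By Cauchy-Schwarz the integer coordinates of such a point have absolute
  sum at most \<open>4 * m\<close>; this form of the constraint makes counting easy.\<close>

definition ball_net :: "'a set \<Rightarrow> ('a \<Rightarrow> real) set" where
  "ball_net D = {z. L2_set z D \<le> 1} \<inter>
     (\<lambda>k. \<lambda>i\<in>D. of_int (k i) / (4 * sqrt (card D))) `
       {k \<in> D \<rightarrow>\<^sub>E {- 4 * int (card D)..4 * int (card D)}. (\<Sum>i\<in>D. \<bar>k i\<bar>) \<le> 4 * int (card D)}"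

text \<open>Rounding towards zero: it does not increase the absolute value, so a rounded vector
  stays in the ball.\<close>

lemma exists_trunc: "\<exists>k::int. \<bar>of_int k\<bar> \<le> \<bar>y\<bar> \<and> \<bar>of_int k - y\<bar> \<le> (1::real)"
proof (cases "y \<ge> 0")
  case True
  then have "0 \<le> real_of_int \<lfloor>y\<rfloor>" by simp
  then show ?thesis using True floor_correct[of y] by (intro exI[of _ "\<lfloor>y\<rfloor>"] conjI; linarith)
next
  case False
  then have "real_of_int \<lceil>y\<rceil> \<le> 0" by simp
  then show ?thesis using False ceiling_correct[of y] by (intro exI[of _ "\<lceil>y\<rceil>"] conjI; linarith)
qed

lemma L2_set_abs: "L2_set (\<lambda>i. \<bar>f i\<bar>) D = L2_set f D"
  by (simp add: L2_set_def)

text \<open>The vector that gets rounded is not \<open>v\<close> but the maximiser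
  \<open>x = c / L\<close>, with \<open>L\<close> the Euclidean norm of \<open>c\<close>. The
  rounding error has norm at most \<open>1/4\<close>, so the net point attains at least
  \<open>3/4 * L\<close>, whereas \<open>v\<close> attains at most \<open>L\<close>.\<close>

lemma ball_net_approx:
  fixes c v :: "'a \<Rightarrow> real"
  assumes "finite D" "D \<noteq> {}" "L2_set v D \<le> 1"
  shows "\<exists>z \<in> ball_net D. (\<Sum>i\<in>D. v i * c i) \<le> 4 / 3 * (\<Sum>i\<in>D. z i * c i)"
proof -
  define m where "m = card D"
  define s where "s = sqrt (real m)"
  define L where "L = L2_set c D"
  \<comment> \<open>If \<open>L = 0\<close>, division by zero yields \<open>x = 0\<close>, and the
    argument still goes through.\<close>
  define x where "x = (\<lambda>i. c i / L)"
  have m: "m > 0" using assms by (simp add: m_def card_gt_0_iff)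
  have s: "s \<ge> 1" "s * s = m" using m by (auto simp: s_def)
  have L0: "L \<ge> 0" by (simp add: L_def)
  have L2: "L\<^sup>2 = (\<Sum>i\<in>D. (c i)\<^sup>2)" by (simp add: L_def L2_set_def sum_nonneg)
  have x_le: "L2_set x D \<le> 1"
  proof -
    have "L2_set x D = (if L = 0 then 0 else 1)"
      using L0 L2_set_right_distrib[of "inverse L" c D] unfolding x_def L_def
      by (auto simp: field_simps L2_set_0')
    then show ?thesis by auto
  qed
  have xc: "(\<Sum>i\<in>D. x i * c i) = L"
  proof (cases "L = 0")
    case False
    have "(\<Sum>i\<in>D. x i * c i) = L\<^sup>2 / L"
      unfolding L2 sum_divide_distrib by (simp add: x_def power2_eq_square)
    then show ?thesis using False by (simp add: power2_eq_square)
  qed (simp add: x_def)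
  have "\<forall>i. \<exists>k::int. \<bar>of_int k\<bar> \<le> \<bar>4 * s * x i\<bar> \<and> \<bar>of_int k - 4 * s * x i\<bar> \<le> 1"
    using exists_trunc by blast
  then obtain k0 :: "'a \<Rightarrow> int" where
    k0: "\<And>i. \<bar>of_int (k0 i)\<bar> \<le> \<bar>4 * s * x i\<bar>" "\<And>i. \<bar>of_int (k0 i) - 4 * s * x i\<bar> \<le> 1" by metis
  define k where "k = restrict k0 D"
  define z where "z = (\<lambda>i\<in>D. of_int (k i) / (4 * s))"
  have z: "z i = of_int (k0 i) / (4 * s)" if "i \<in> D" for i using that by (simp add: z_def k_def)
  have z_le: "\<bar>z i\<bar> \<le> \<bar>x i\<bar>" if "i \<in> D" for i
    using k0(1)[of i] s by (simp add: z that abs_mult field_simps)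
  have z_diff: "\<bar>z i - x i\<bar> \<le> 1 / (4 * s)" if "i \<in> D" for i
  proof -
    have "z i - x i = (of_int (k0 i) - 4 * s * x i) / (4 * s)" using s by (simp add: z that field_simps)
    then have "\<bar>z i - x i\<bar> = \<bar>of_int (k0 i) - 4 * s * x i\<bar> / (4 * s)" using s by (simp add: abs_divide)
    also have "\<dots> \<le> 1 / (4 * s)" using s k0(2) by (intro divide_right_mono) auto
    finally show ?thesis .
  qed
  have "L2_set z D = L2_set (\<lambda>i. \<bar>z i\<bar>) D" by (simp add: L2_set_abs)
  also have "\<dots> \<le> L2_set (\<lambda>i. \<bar>x i\<bar>) D" by (intro L2_set_mono z_le) auto
  finally have L2z: "L2_set z D \<le> 1" using x_le by (simp add: L2_set_abs)
  have sum_x: "(\<Sum>i\<in>D. \<bar>x i\<bar>) \<le> s"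
  proof -
    have "(\<Sum>i\<in>D. \<bar>x i\<bar> * \<bar>1\<bar>) \<le> L2_set x D * L2_set (\<lambda>_. 1) D" by (rule L2_set_mult_ineq)
    also have "L2_set (\<lambda>_. 1::real) D = s" by (simp add: L2_set_constant s_def m_def)
    also have "L2_set x D * s \<le> 1 * s" using x_le s by (intro mult_right_mono) auto
    finally show ?thesis by simp
  qed
  have "of_int (\<Sum>i\<in>D. \<bar>k i\<bar>) = (\<Sum>i\<in>D. \<bar>of_int (k0 i)\<bar> :: real)"
    by (simp add: k_def)
  also have "\<dots> \<le> (\<Sum>i\<in>D. \<bar>4 * s * x i\<bar>)" by (intro sum_mono k0)
  also have "\<dots> = 4 * s * (\<Sum>i\<in>D. \<bar>x i\<bar>)" using s by (simp add: abs_mult sum_distrib_left)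
  also have "\<dots> \<le> 4 * s * s" using sum_x s by (intro mult_left_mono) auto
  finally have "real_of_int (\<Sum>i\<in>D. \<bar>k i\<bar>) \<le> real_of_int (4 * int m)" using s(2) by simp
  then have sum_k: "(\<Sum>i\<in>D. \<bar>k i\<bar>) \<le> 4 * int m" by (simp only: of_int_le_iff)
  have k_le: "\<bar>k i\<bar> \<le> 4 * int m" if "i \<in> D" for i
  proof -
    have "\<bar>k i\<bar> \<le> (\<Sum>i\<in>D. \<bar>k i\<bar>)" by (rule member_le_sum) (use that assms in auto)
    then show ?thesis using sum_k by linarith
  qed
  have "z \<in> ball_net D"
    unfolding ball_net_def
  proof (intro IntI image_eqI)
    show "z = (\<lambda>i\<in>D. of_int (k i) / (4 * sqrt (card D)))" by (simp add: z_def s_def m_def)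
    show "k \<in> {k \<in> D \<rightarrow>\<^sub>E {- 4 * int (card D)..4 * int (card D)}. (\<Sum>i\<in>D. \<bar>k i\<bar>) \<le> 4 * int (card D)}"
      using sum_k k_le by (fastforce simp: k_def m_def abs_le_iff)
  qed (use L2z in auto)
  moreover have "(\<Sum>i\<in>D. v i * c i) \<le> 4 / 3 * (\<Sum>i\<in>D. z i * c i)"
  proof -
    have "(\<Sum>i\<in>D. v i * c i) \<le> (\<Sum>i\<in>D. \<bar>v i\<bar> * \<bar>c i\<bar>)"
      by (intro sum_mono) (metis abs_ge_self abs_mult)
    also have "\<dots> \<le> L2_set v D * L" unfolding L_def by (rule L2_set_mult_ineq)
    also have "\<dots> \<le> L" using assms(3) L0 by (simp add: mult_left_le_one_le)
    finally have vL: "(\<Sum>i\<in>D. v i * c i) \<le> L" .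
    \<comment> \<open>Here \<open>s = sqrt m\<close>, so \<open>m\<close> coordinate errors of size
      \<open>1 / (4 * s)\<close> have Euclidean norm exactly \<open>1/4\<close>.\<close>
    have "L2_set (\<lambda>i. z i - x i) D \<le> L2_set (\<lambda>_. 1 / (4 * s)) D"
      by (subst L2_set_abs[symmetric]) (intro L2_set_mono z_diff, auto)
    also have "\<dots> = 1 / 4"
      using s by (simp add: L2_set_constant flip: s_def m_def)
    finally have diff: "L2_set (\<lambda>i. z i - x i) D \<le> 1 / 4" .
    have "L - (\<Sum>i\<in>D. z i * c i) = (\<Sum>i\<in>D. - ((z i - x i) * c i))"
      by (simp add: xc[symmetric] sum_subtractf algebra_simps)
    also have "\<dots> \<le> (\<Sum>i\<in>D. \<bar>z i - x i\<bar> * \<bar>c i\<bar>)"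
      by (intro sum_mono) (metis abs_ge_minus_self abs_mult)
    also have "\<dots> \<le> L2_set (\<lambda>i. z i - x i) D * L" unfolding L_def by (rule L2_set_mult_ineq)
    also have "\<dots> \<le> 1 / 4 * L" using diff L0 by (intro mult_right_mono) auto
    finally show ?thesis using vL by linarith
  qed
  ultimately show ?thesis by blast
qed

lemma sum_half_power_abs_le: "(\<Sum>k=-int N..int N. (1/2::real) ^ nat \<bar>k\<bar>) \<le> 3"
proof -
  have "(\<Sum>k=-int N..int N. (1/2::real) ^ nat \<bar>k\<bar>) = 3 - 2 * (1/2) ^ N"
  proof (induction N)
    case (Suc N)
    have "{-int (Suc N)..int (Suc N)} = insert (- int (Suc N)) (insert (int (Suc N)) {-int N..int N})"
      by auto
    then have "(\<Sum>k=-int (Suc N)..int (Suc N). (1/2::real) ^ nat \<bar>k\<bar>)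
        = 2 * (1/2) ^ Suc N + (\<Sum>k=-int N..int N. (1/2::real) ^ nat \<bar>k\<bar>)"
      by (simp add: nat_add_distrib)
    then show ?case using Suc by simp
  qed simp
  then show ?thesis by simp
qed

lemma finite_ball_net:
  assumes "finite D"
  shows "finite (ball_net D)"
proof -
  have "finite (D \<rightarrow>\<^sub>E {- 4 * int (card D)..4 * int (card D)})"
    using assms by (intro finite_PiE) auto
  then show ?thesis unfolding ball_net_def by simp
qed

text \<open>Each admissible integer vector \<open>k\<close> has weight
  \<open>2 ^ (4 * m) * (\<Prod>i\<in>D. (1/2) ^ nat \<bar>k i\<bar>)\<close> at least 1. The sum of
  these weights over the whole box factorises into geometric sums of size at most 3, which gives the
  base \<open>16 * 3 = 48\<close>.\<close>

lemma card_ball_net_le: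
  assumes "finite D"
  shows "real (card (ball_net D)) \<le> 48 ^ card D"
proof -
  define m where "m = card D"
  let ?R = "{- int (4 * m)..int (4 * m)}"
  let ?K = "{k \<in> D \<rightarrow>\<^sub>E ?R. (\<Sum>i\<in>D. \<bar>k i\<bar>) \<le> int (4 * m)}"
  have finK: "finite (D \<rightarrow>\<^sub>E ?R)" using assms by (intro finite_PiE) auto
  have "card (ball_net D) \<le> card ?K"
  proof -
    have "ball_net D \<subseteq> (\<lambda>k. \<lambda>i\<in>D. of_int (k i) / (4 * sqrt m)) ` ?K"
      unfolding ball_net_def m_def by auto
    moreover have "finite ?K" using finK by simp
    ultimately show ?thesis
      by (intro order_trans[OF card_mono card_image_le] finite_imageI)
  qed
  then have "real (card (ball_net D)) \<le> card ?K" by simp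
  also have "\<dots> \<le> (\<Sum>k\<in>D \<rightarrow>\<^sub>E ?R. 2 ^ (4 * m) * (\<Prod>i\<in>D. (1/2) ^ nat \<bar>k i\<bar>))"
  proof -
    have "1 \<le> 2 ^ (4 * m) * (\<Prod>i\<in>D. (1/2::real) ^ nat \<bar>k i\<bar>)" if "(\<Sum>i\<in>D. \<bar>k i\<bar>) \<le> int (4 * m)" for k
    proof -
      have "int (\<Sum>i\<in>D. nat \<bar>k i\<bar>) \<le> int (4 * m)" using that by simp
      then have "(\<Sum>i\<in>D. nat \<bar>k i\<bar>) \<le> 4 * m" by (simp only: of_nat_le_iff)
      then have "(1/2::real) ^ (4 * m) \<le> (1/2) ^ (\<Sum>i\<in>D. nat \<bar>k i\<bar>)"
        by (intro power_decreasing) auto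
      also have "\<dots> = (\<Prod>i\<in>D. (1/2) ^ nat \<bar>k i\<bar>)" by (simp add: power_sum)
      finally have "2 ^ (4 * m) * (1/2::real) ^ (4 * m) \<le> 2 ^ (4 * m) * (\<Prod>i\<in>D. (1/2) ^ nat \<bar>k i\<bar>)"
        by (intro mult_left_mono) auto
      then show ?thesis by (simp flip: power_mult_distrib)
    qed
    then have "real (card ?K) \<le> (\<Sum>k\<in>?K. 2 ^ (4 * m) * (\<Prod>i\<in>D. (1/2) ^ nat \<bar>k i\<bar>))"
      using sum_mono[of ?K "\<lambda>_. 1::real"] by simp
    also have "\<dots> \<le> (\<Sum>k\<in>D \<rightarrow>\<^sub>E ?R. 2 ^ (4 * m) * (\<Prod>i\<in>D. (1/2) ^ nat \<bar>k i\<bar>))"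
      using finK by (intro sum_mono2) (auto intro!: prod_nonneg mult_nonneg_nonneg)
    finally show ?thesis .
  qed
  also have "\<dots> = 2 ^ (4 * m) * (\<Sum>k\<in>D \<rightarrow>\<^sub>E ?R. \<Prod>i\<in>D. (1/2) ^ nat \<bar>k i\<bar>)"
    by (simp only: sum_distrib_left)
  also have "(\<Sum>k\<in>D \<rightarrow>\<^sub>E ?R. \<Prod>i\<in>D. (1/2::real) ^ nat \<bar>k i\<bar>) = (\<Prod>i\<in>D. \<Sum>k\<in>?R. (1/2) ^ nat \<bar>k\<bar>)"
    by (rule prod_sum_PiE[symmetric]) (use assms in auto)
  also have "\<dots> \<le> (\<Prod>i\<in>D. 3)"
    using sum_half_power_abs_le[of "4 * m"] by (intro prod_mono) (auto intro!: sum_nonneg)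
  also have "(\<Prod>i\<in>D. 3::real) = 3 ^ m" by (simp add: m_def)
  finally show ?thesis
    by (simp add: m_def power_mult flip: power_mult_distrib)
qed

section \<open>From nets for single vectors to nets for multilinear forms\<close>

definition multilinear_form ::
  "'a set \<Rightarrow> ('a \<Rightarrow> 'b set) \<Rightarrow> (('a \<Rightarrow> 'b) \<Rightarrow> real) \<Rightarrow> ('a \<Rightarrow> 'b \<Rightarrow> real) \<Rightarrow> real" where
  "multilinear_form K D B u = (\<Sum>\<eta>\<in>PiE K D. B \<eta> * (\<Prod>l\<in>K. u l (\<eta> l)))"

text \<open>Linearity in one argument, with explicit coefficients: they are the values of the form
  at the standard basis vectors, written as \<open>of_bool (i = b)\<close>.\<close>

lemma multilinear_form_upd:
  assumes "finite K" "j \<in> K" "finite (D j)"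
  shows "multilinear_form K D B (u(j := v))
       = (\<Sum>b\<in>D j. v b * multilinear_form K D B (u(j := \<lambda>i. of_bool (i = b))))"
proof -
  let ?P = "\<lambda>\<eta>. \<Prod>l\<in>K - {j}. u l (\<eta> l)"
  have P: "(\<Prod>l\<in>K. (u(j := w)) l (\<eta> l)) = w (\<eta> j) * ?P \<eta>" for w \<eta>
    using assms by (simp add: prod.remove[of K j])
  have "multilinear_form K D B (u(j := v)) = (\<Sum>\<eta>\<in>PiE K D. \<Sum>b\<in>D j. v b * (B \<eta> * (of_bool (\<eta> j = b) * ?P \<eta>)))"
    unfolding multilinear_form_def P
  proof (intro sum.cong refl)
    fix \<eta> assume "\<eta> \<in> PiE K D"
    then have \<eta>: "\<eta> j \<in> D j" using assms by auto
    have "(\<Sum>b\<in>D j. v b * (B \<eta> * (of_bool (\<eta> j = b) * ?P \<eta>)))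
        = (\<Sum>b\<in>D j. if \<eta> j = b then v b * (B \<eta> * ?P \<eta>) else 0)"
      by (intro sum.cong) auto
    then show "B \<eta> * (v (\<eta> j) * ?P \<eta>) = (\<Sum>b\<in>D j. v b * (B \<eta> * (of_bool (\<eta> j = b) * ?P \<eta>)))"
      using \<eta> assms by (simp add: mult_ac)
  qed
  also have "\<dots> = (\<Sum>b\<in>D j. v b * multilinear_form K D B (u(j := \<lambda>i. of_bool (i = b))))"
    by (subst sum.swap) (simp only: multilinear_form_def P sum_distrib_left)
  finally show ?thesis .
qed

lemma multilinear_form_cong:
  "(\<And>l. l \<in> K \<Longrightarrow> u l = v l) \<Longrightarrow> multilinear_form K D B u = multilinear_form K D B v"
  by (auto simp: multilinear_form_def intro!: sum.cong prod.cong)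

text \<open>The vectors are replaced one mode at a time. With the others frozen the form is linear
  in the current vector, so its net costs a factor \<open>\<kappa> j\<close>. The net hypothesis
  ranges over all \<open>c\<close> because the coefficients depend on the vectors already
  replaced.\<close>

lemma multilinear_form_net:
  assumes "finite K" "\<And>j. j \<in> K \<Longrightarrow> finite (D j)" "\<And>j. j \<in> K \<Longrightarrow> 0 \<le> \<kappa> j"
    and net: "\<And>j c. j \<in> K \<Longrightarrow> \<exists>z\<in>N j. (\<Sum>b\<in>D j. u j b * c b) \<le> \<kappa> j * (\<Sum>b\<in>D j. z b * c b)"
  shows "\<exists>z\<in>PiE K N. multilinear_form K D B u \<le> (\<Prod>j\<in>K. \<kappa> j) * multilinear_form K D B z"
proof -
  have "\<exists>z\<in>PiE J N. multilinear_form K D B u \<le> (\<Prod>j\<in>J. \<kappa> j) * multilinear_form K D B (override_on u z J)"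
    if "finite J" "J \<subseteq> K" for J
    using that
  proof (induction J rule: finite_induct)
    case (insert j J)
    let ?F = "multilinear_form K D B"
    have jK: "j \<in> K" and JK: "J \<subseteq> K" and jJ: "j \<notin> J" and finJ: "finite J" using insert by auto
    obtain z where z: "z \<in> PiE J N" "?F u \<le> (\<Prod>j\<in>J. \<kappa> j) * ?F (override_on u z J)"
      using insert.IH[OF JK] by blast
    define w where "w = override_on u z J"
    have finD: "finite (D j)" using jK assms by auto
    \<comment> \<open>Mode \<open>j\<close> has not been replaced yet, so \<open>w\<close> still
      carries \<open>u j\<close> there.\<close>
    have wj: "w(j := u j) = w" using jJ by (simp add: w_def fun_eq_iff)
    obtain y where y: "y \<in> N j"
      "(\<Sum>b\<in>D j. u j b * ?F (w(j := \<lambda>i. of_bool (i = b))))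
         \<le> \<kappa> j * (\<Sum>b\<in>D j. y b * ?F (w(j := \<lambda>i. of_bool (i = b))))"
      using net[OF jK, of "\<lambda>b. ?F (w(j := \<lambda>i. of_bool (i = b)))"] by auto
    have "?F w \<le> \<kappa> j * ?F (w(j := y))"
      using y(2)
      unfolding multilinear_form_upd[of K j D B w "u j", OF assms(1) jK finD, symmetric]
        multilinear_form_upd[of K j D B w y, OF assms(1) jK finD, symmetric] wj .
    then have "(\<Prod>j\<in>J. \<kappa> j) * ?F w \<le> (\<Prod>j\<in>J. \<kappa> j) * (\<kappa> j * ?F (w(j := y)))"
      using JK assms(3) by (intro mult_left_mono prod_nonneg) auto
    also have "\<dots> = (\<Prod>j\<in>insert j J. \<kappa> j) * ?F (w(j := y))" using jJ finJ by simp
    also have "w(j := y) = override_on u (z(j := y)) (insert j J)"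
      using jJ by (auto simp: w_def fun_eq_iff override_on_def)
    finally have "?F u \<le> (\<Prod>j\<in>insert j J. \<kappa> j) * ?F (override_on u (z(j := y)) (insert j J))"
      using z(2) unfolding w_def by linarith
    moreover have "z(j := y) \<in> PiE (insert j J) N" using z(1) y(1) by (simp add: PiE_fun_upd)
    ultimately show ?case by (rule bexI)
  qed simp
  from this[OF assms(1) order_refl] obtain z where "z \<in> PiE K N"
    "multilinear_form K D B u \<le> (\<Prod>j\<in>K. \<kappa> j) * multilinear_form K D B (override_on u z K)" by blast
  moreover have "multilinear_form K D B (override_on u z K) = multilinear_form K D B z"
    by (rule multilinear_form_cong) simp
  ultimately show ?thesis by metis
qed

section \<open>Reduction to counting\<close>

text \<open>By independence every outcome tuple has probability \<open>1 / card I ^ n\<close>, and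
  the event is the disjoint union of the outcomes satisfying \<open>P\<close>. The sample is
  restricted to \<open>{1..n}\<close> so that it is an element of the extensional product.\<close>

lemma prob_iid_uniform:
  assumes "prob_space M" "finite I" "I \<noteq> {}" "n \<ge> 1" and iid: "iid_uniform M I n \<omega>"
  shows "measure M {x \<in> space M. P (\<lambda>i\<in>{1..n}. \<omega> i x)} = card {w \<in> {1..n} \<rightarrow>\<^sub>E I. P w} / card I ^ n"
proof -
  interpret prob_space M by fact
  let ?S = "{1..n} \<rightarrow>\<^sub>E I"
  define E where "E = (\<lambda>w. \<Inter>i\<in>{1..n}. \<omega> i -` {w i} \<inter> space M)"
  have indep: "indep_vars (\<lambda>_. count_space I) \<omega> {1..n}"
    and unif: "\<And>i. i \<in> {1..n} \<Longrightarrow> distr M (count_space I) (\<omega> i) = uniform_count_measure I"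
    using iid by (auto simp: iid_uniform_def)
  have rv: "\<omega> i \<in> measurable M (count_space I)" if "i \<in> {1..n}" for i
    using indep that by (auto simp: indep_vars_def)
  have fin: "finite ?S" using assms by (intro finite_PiE) auto
  have single: "prob (\<omega> i -` {v} \<inter> space M) = 1 / card I" if "i \<in> {1..n}" "v \<in> I" for i v
  proof -
    have "prob (\<omega> i -` {v} \<inter> space M) = measure (distr M (count_space I) (\<omega> i)) {v}"
      using rv that by (subst measure_distr) auto
    also have "\<dots> = 1 / card I"
      using that assms by (simp add: unif measure_uniform_count_measure)
    finally show ?thesis .
  qed
  have E_sets: "E w \<in> sets M" if "w \<in> ?S" for w
    unfolding E_def using \<open>n \<ge> 1\<close> that
    by (intro sets.countable_INT') (auto intro!: measurable_sets[OF rv])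
  have prob_E: "prob (E w) = 1 / card I ^ n" if w: "w \<in> ?S" for w
  proof -
    have "prob (E w) = (\<Prod>i\<in>{1..n}. prob (\<omega> i -` {w i} \<inter> space M))"
      unfolding E_def by (rule indep_varsD[OF indep]) (use \<open>n \<ge> 1\<close> w in auto)
    also have "\<dots> = (\<Prod>i\<in>{1..n}. 1 / card I)"
      by (intro prod.cong refl single) (use w in auto)
    finally show ?thesis by (simp add: power_one_over)
  qed
  have E_iff: "x \<in> E w \<longleftrightarrow> x \<in> space M \<and> (\<lambda>i\<in>{1..n}. \<omega> i x) = w" if "w \<in> ?S" for x w
  proof
    assume "x \<in> E w"
    then have "x \<in> space M" "\<And>i. i \<in> {1..n} \<Longrightarrow> \<omega> i x = w i"
      using \<open>n \<ge> 1\<close> by (auto simp: E_def)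
    then show "x \<in> space M \<and> (\<lambda>i\<in>{1..n}. \<omega> i x) = w"
      using PiE_arb[OF that] by (auto simp: fun_eq_iff)
  next
    assume "x \<in> space M \<and> (\<lambda>i\<in>{1..n}. \<omega> i x) = w"
    then show "x \<in> E w" by (auto simp: E_def)
  qed
  have mem: "(\<lambda>i\<in>{1..n}. \<omega> i x) \<in> ?S" if "x \<in> space M" for x
    using measurable_space[OF rv that] by auto
  have "{x \<in> space M. P (\<lambda>i\<in>{1..n}. \<omega> i x)} = (\<Union>w\<in>{w \<in> ?S. P w}. E w)"
  proof (intro equalityI subsetI)
    fix x assume x: "x \<in> {x \<in> space M. P (\<lambda>i\<in>{1..n}. \<omega> i x)}"
    then have "x \<in> E (\<lambda>i\<in>{1..n}. \<omega> i x)" using mem by (subst E_iff) auto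
    moreover have "(\<lambda>i\<in>{1..n}. \<omega> i x) \<in> {w \<in> ?S. P w}" using x mem by simp
    ultimately show "x \<in> (\<Union>w\<in>{w \<in> ?S. P w}. E w)" by (rule UN_I[rotated])
  next
    fix x assume "x \<in> (\<Union>w\<in>{w \<in> ?S. P w}. E w)"
    then obtain w where w: "w \<in> ?S" "P w" "x \<in> E w" by blast
    then have "x \<in> space M" "(\<lambda>i\<in>{1..n}. \<omega> i x) = w" using E_iff[OF w(1), of x] by auto
    then show "x \<in> {x \<in> space M. P (\<lambda>i\<in>{1..n}. \<omega> i x)}" using w(2) by simp
  qed
  also have "prob \<dots> = (\<Sum>w\<in>{w \<in> ?S. P w}. prob (E w))"
  proof (rule finite_measure_finite_Union)
    show "disjoint_family_on E {w \<in> ?S. P w}"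
      unfolding disjoint_family_on_def by (auto simp: E_iff)
  qed (use fin E_sets in auto)
  also have "\<dots> = (\<Sum>w\<in>{w \<in> ?S. P w}. 1 / card I ^ n)"
    by (intro sum.cong refl prob_E) auto
  finally show ?thesis by simp
qed

section \<open>The norm for a fixed pair of modes\<close>

text \<open>Fixing two coordinates replaces two factors of the product by singletons. Hence all
  cells have the same size, as \<open>uniform_cells\<close> requires.\<close>

lemma card_PiE_two_fixed:
  assumes "finite K" "j1 \<in> K" "j2 \<in> K" "j1 \<noteq> j2" "a \<in> D j1" "b \<in> D j2"
  shows "card {\<eta> \<in> PiE K D. (\<eta> j1, \<eta> j2) = (a, b)} * card (D j1 \<times> D j2) = card (PiE K D)"
proof -
  have eq: "{\<eta> \<in> PiE K D. (\<eta> j1, \<eta> j2) = (a, b)} = PiE K (D(j1 := {a}, j2 := {b}))"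
    using assms by (auto simp: PiE_iff extensional_def split: if_splits)
  have K: "K = insert j1 (insert j2 (K - {j1, j2}))" using assms by auto
  have prodK: "(\<Prod>l\<in>K. g l) = g j1 * (g j2 * (\<Prod>l\<in>K - {j1, j2}. g l))" for g :: "'a \<Rightarrow> nat"
    by (subst K) (use assms in simp)
  have "(\<Prod>l\<in>K - {j1, j2}. card ((D(j1 := {a}, j2 := {b})) l)) = (\<Prod>l\<in>K - {j1, j2}. card (D l))"
    by (intro prod.cong) auto
  then show ?thesis
    unfolding eq using assms by (simp add: card_PiE prodK card_cartesian_product)
qed

locale mode_pair =
  fixes k :: nat and d :: "nat \<Rightarrow> nat" and \<delta> :: "nat \<Rightarrow> real" and j1 j2 :: nat
  assumes d_pos: "j \<in> {1..k} \<Longrightarrow> d j \<ge> 1"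
    and \<delta>_pos: "j \<in> {1..k} \<Longrightarrow> \<delta> j > 0"
    and pair: "(j1, j2) \<in> mode_pairs k"
begin

lemma pair_mem: "j1 \<in> {1..k}" "j2 \<in> {1..k}" "j1 \<noteq> j2"
  using pair by (auto simp: mode_pairs_def)

text \<open>Outside \<open>j1\<close> and \<open>j2\<close> only the sup-norm constraint is
  retained: vertices of the cube may leave the unit ball, but their entries have constant absolute
  value.\<close>

definition net :: "(nat \<Rightarrow> nat \<Rightarrow> real) set" where
  "net = (\<Pi>\<^sub>E j\<in>{1..k}. if j \<in> {j1, j2} then ball_net {1..d j} else {1..d j} \<rightarrow>\<^sub>E {- \<delta> j, \<delta> j})"

text \<open>The common absolute value of the factor that the modes other than \<open>j1\<close> and
  \<open>j2\<close> contribute to an entry of a net tensor.\<close>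

definition rest_scale :: real where
  "rest_scale = (\<Prod>j\<in>{1..k} - {j1, j2}. \<delta> j)"

lemma rest_scale_pos: "rest_scale > 0"
  unfolding rest_scale_def by (intro prod_pos) (use \<delta>_pos in auto)

lemma prod_split_pair: "(\<Prod>l\<in>{1..k}. g l) = g j1 * g j2 * (\<Prod>l\<in>{1..k} - {j1, j2}. g l)"
  for g :: "nat \<Rightarrow> 'c :: comm_monoid_mult"
proof -
  have "{1..k} = insert j1 (insert j2 ({1..k} - {j1, j2}))" using pair_mem by auto
  then have "(\<Prod>l\<in>{1..k}. g l) = (\<Prod>l\<in>insert j1 (insert j2 ({1..k} - {j1, j2})). g l)" by simp
  then show ?thesis using pair_mem by (simp add: mult_ac)
qed

lemma finite_net: "finite net"
  unfolding net_def by (intro finite_PiE) (auto intro!: finite_ball_net finite_PiE)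

lemma card_net_le: "real (card net) \<le> 48 ^ (\<Sum>j=1..k. d j)"
proof -
  have "real (card net) = (\<Prod>j=1..k. real (card (if j \<in> {j1, j2} then ball_net {1..d j} else {1..d j} \<rightarrow>\<^sub>E {- \<delta> j, \<delta> j})))"
    unfolding net_def by (simp add: card_PiE)
  also have "\<dots> \<le> (\<Prod>j=1..k. 48 ^ d j)"
  proof (intro prod_mono conjI)
    fix j assume j: "j \<in> {1..k}"
    have "real (card ({1..d j} \<rightarrow>\<^sub>E {- \<delta> j, \<delta> j})) = (real (card {- \<delta> j, \<delta> j})) ^ d j"
      by (simp add: card_PiE)
    also have "\<dots> \<le> 48 ^ d j" by (intro power_mono) (auto simp: card_insert_if)
    finally show "real (card (if j \<in> {j1, j2} then ball_net {1..d j} else {1..d j} \<rightarrow>\<^sub>E {- \<delta> j, \<delta> j})) \<le> 48 ^ d j"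
      using card_ball_net_le[of "{1..d j}"] by simp
  qed auto
  finally show ?thesis by (simp add: power_sum)
qed

text \<open>Each of the two ball nets costs \<open>4/3\<close> and the cube vertices cost nothing,
  hence the factor \<open>16/9\<close>.\<close>

lemma incoherent_pair_le_net:
  assumes "Y \<in> incoherent_pair_set k d \<delta> (j1, j2)"
  shows "\<exists>z\<in>net. tensor_inner k d Y X \<le> 16 / 9 * multilinear_form {1..k} (\<lambda>j. {1..d j}) X z"
proof -
  let ?N = "\<lambda>j. if j \<in> {j1, j2} then ball_net {1..d j} else {1..d j} \<rightarrow>\<^sub>E {- \<delta> j, \<delta> j}"
  define \<kappa> :: "nat \<Rightarrow> real" where "\<kappa> = (\<lambda>j. if j \<in> {j1, j2} then 4 / 3 else 1)"
  obtain u where Y: "Y = rank_one_tensor k u"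
    and u2: "\<And>j. j \<in> {1..k} \<Longrightarrow> l2_norm (d j) (u j) \<le> 1"
    and uinf: "\<And>j. j \<in> {1..k} - {j1, j2} \<Longrightarrow> linf_norm (d j) (u j) \<le> \<delta> j"
    using assms unfolding incoherent_pair_set_def by auto
  have "\<exists>z\<in>PiE {1..k} ?N. multilinear_form {1..k} (\<lambda>j. {1..d j}) X u
     \<le> (\<Prod>j\<in>{1..k}. \<kappa> j) * multilinear_form {1..k} (\<lambda>j. {1..d j}) X z"
  proof (rule multilinear_form_net)
    fix j and c :: "nat \<Rightarrow> real" assume j: "j \<in> {1..k}"
    show "\<exists>z\<in>?N j. (\<Sum>b\<in>{1..d j}. u j b * c b) \<le> \<kappa> j * (\<Sum>b\<in>{1..d j}. z b * c b)"
    proof (cases "j \<in> {j1, j2}")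
      case True
      then show ?thesis
        using ball_net_approx[of "{1..d j}" "u j" c] u2[OF j] d_pos[OF j]
        by (simp add: \<kappa>_def l2_norm_def)
    next
      case False
      have "\<bar>u j i\<bar> \<le> \<delta> j" if "i \<in> {1..d j}" for i
      proof -
        have "\<bar>u j i\<bar> \<le> linf_norm (d j) (u j)" unfolding linf_norm_def by (rule Max_ge) (use that in auto)
        then show ?thesis using uinf[of j] j False by auto
      qed
      then show ?thesis using sign_net[of "{1..d j}" "u j" "\<delta> j" c] False by (simp add: \<kappa>_def)
    qed
  qed (auto simp: \<kappa>_def)
  moreover have "(\<Prod>j\<in>{1..k}. \<kappa> j) = 16 / 9"
    unfolding prod_split_pair by (simp add: \<kappa>_def)
  moreover have "tensor_inner k d Y X = multilinear_form {1..k} (\<lambda>j. {1..d j}) X u"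
    by (simp add: tensor_inner_def multilinear_form_def Y rank_one_tensor_def tensor_index_def mult.commute)
  ultimately show ?thesis unfolding net_def by (simp only:)
qed

lemma net_entries:
  assumes "z \<in> net"
  shows "L2_set (z j1) {1..d j1} \<le> 1" "L2_set (z j2) {1..d j2} \<le> 1"
    "\<And>j i. j \<in> {1..k} - {j1, j2} \<Longrightarrow> i \<in> {1..d j} \<Longrightarrow> \<bar>z j i\<bar> = \<delta> j"
proof -
  have z: "z j \<in> (if j \<in> {j1, j2} then ball_net {1..d j} else {1..d j} \<rightarrow>\<^sub>E {- \<delta> j, \<delta> j})" if "j \<in> {1..k}" for j
    using assms that unfolding net_def by (rule PiE_mem)
  show "L2_set (z j1) {1..d j1} \<le> 1" "L2_set (z j2) {1..d j2} \<le> 1"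
    using z[OF pair_mem(1)] z[OF pair_mem(2)] by (auto simp: ball_net_def)
  fix j i assume j: "j \<in> {1..k} - {j1, j2}" and i: "i \<in> {1..d j}"
  then have "z j i \<in> {- \<delta> j, \<delta> j}" using z[of j] by auto
  then show "\<bar>z j i\<bar> = \<delta> j" using \<delta>_pos[of j] j by auto
qed

text \<open>Constant absolute value in the remaining modes makes the square depend on
  \<open>\<eta>\<close> only through its cell \<open>(\<eta> j1, \<eta> j2)\<close>. This supplies
  the weight function needed in \<open>deviation_off_overfull\<close>.\<close>

lemma prod_net_sq:
  assumes "z \<in> net" "\<eta> \<in> tensor_index k d"
  shows "(\<Prod>l\<in>{1..k}. z l (\<eta> l))\<^sup>2 = (z j1 (\<eta> j1))\<^sup>2 * (z j2 (\<eta> j2))\<^sup>2 * rest_scale\<^sup>2"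
proof -
  have \<eta>: "\<eta> l \<in> {1..d l}" if "l \<in> {1..k}" for l
    using assms(2) that unfolding tensor_index_def by (rule PiE_mem)
  have "(\<Prod>l\<in>{1..k} - {j1, j2}. (z l (\<eta> l))\<^sup>2) = (\<Prod>l\<in>{1..k} - {j1, j2}. (\<delta> l)\<^sup>2)"
  proof (intro prod.cong refl)
    fix l assume "l \<in> {1..k} - {j1, j2}"
    then show "(z l (\<eta> l))\<^sup>2 = (\<delta> l)\<^sup>2" using net_entries(3)[OF assms(1), of l "\<eta> l"] \<eta>[of l]
      by (metis DiffD1 power2_abs)
  qed
  then show ?thesis
    unfolding prod_power_distrib[symmetric] prod_split_pair rest_scale_def
    by (simp add: prod_power_distrib power_mult_distrib)
qed

definition tensor_cells :: "(nat \<times> nat) set" where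
  "tensor_cells = {1..d j1} \<times> {1..d j2}"

lemma uniform_cells_pair:
  assumes "finite J"
  shows "uniform_cells J (tensor_index k d) tensor_cells (\<lambda>\<eta>. (\<eta> j1, \<eta> j2))"
proof
  show "tensor_index k d \<noteq> {}" using d_pos by (auto simp: tensor_index_def PiE_eq_empty_iff)
  show "(\<lambda>\<eta>. (\<eta> j1, \<eta> j2)) ` tensor_index k d \<subseteq> tensor_cells"
    using pair_mem PiE_mem[of _ "{1..k}" "\<lambda>j. {1..d j}"] unfolding tensor_cells_def tensor_index_def by blast
  show "card {v \<in> tensor_index k d. (v j1, v j2) = c} * card tensor_cells = card (tensor_index k d)"
    if "c \<in> tensor_cells" for c
    using card_PiE_two_fixed[of "{1..k}" j1 j2 "fst c" "\<lambda>j. {1..d j}" "snd c"] pair_mem that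
    by (auto simp: tensor_cells_def tensor_index_def)
qed (use assms in \<open>auto simp: tensor_index_def tensor_cells_def intro!: finite_PiE\<close>)

lemma card_tensor_cells: "card tensor_cells = d j1 * d j2"
  by (simp add: tensor_cells_def card_cartesian_product)

text \<open>Union bound over the net. For a net point \<open>z\<close>, the values
  \<open>A \<eta> * (\<Prod>l\<in>{1..k}. z l (\<eta> l))\<close> divided by
  \<open>a * rest_scale\<close> have squares bounded by cell weights of total at most 1, and
  \<open>2 * \<tau>\<close> is the threshold \<open>t / 2\<close> in the same units, for the sum
  instead of the mean.\<close>

lemma net_deviation:
  fixes a t \<tau> \<nu> :: real and n :: nat
  assumes "n \<ge> 1" and A: "a > 0" "\<And>\<eta>. \<eta> \<in> tensor_index k d \<Longrightarrow> \<bar>A \<eta>\<bar> \<le> a"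
    and \<tau>_def: "\<tau> = n * t / (4 * card (tensor_index k d) * a * rest_scale)"
    and \<nu>: "\<nu> > 0" "4 * (d j1 * d j2 * exp (2 * n / (d j1 * d j2) - \<nu>)) \<le> 1"
    and \<tau>: "2 \<le> \<tau>" "4 * n / (d j1 * d j2) \<le> \<tau>\<^sup>2"
  shows "card {w \<in> {1..n} \<rightarrow>\<^sub>E tensor_index k d. \<exists>z\<in>net. t / 2 \<le>
             multilinear_form {1..k} (\<lambda>j. {1..d j}) (\<lambda>\<eta>. sample_mean n (\<lambda>i. sampled_tensor k d A (w i)) \<eta> - A \<eta>) z}
           \<le> card (tensor_index k d) ^ n *
              (d j1 * d j2 * exp (2 * n / (d j1 * d j2) - \<nu>)
               + 48 ^ (\<Sum>j=1..k. d j) * (4 * exp (- \<tau>\<^sup>2 / (8 * \<nu>))))"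
proof -
  let ?I = "tensor_index k d" and ?J = "{1..n}"
  let ?S = "?J \<rightarrow>\<^sub>E ?I"
  interpret uniform_cells ?J ?I tensor_cells "\<lambda>\<eta>. (\<eta> j1, \<eta> j2)"
    by (rule uniform_cells_pair) simp
  define X where "X = (\<lambda>w \<eta>. sample_mean n (\<lambda>i. sampled_tensor k d A (w i)) \<eta> - A \<eta>)"
  define h where "h = (\<lambda>z \<eta>. A \<eta> * (\<Prod>l\<in>{1..k}. z l (\<eta> l)))"
  define f where "f = (\<lambda>z \<eta>. h z \<eta> / (a * rest_scale))"
  have Npos: "real (card ?I) > 0" using card_I_pos by simp
  have prod_d: "(\<Prod>j=1..k. real (d j)) = card ?I"
    by (simp add: tensor_index_def card_PiE)
  have scale: "a * rest_scale > 0" using A(1) rest_scale_pos by simp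
  \<comment> \<open>A sampled tensor has a single entry, so the form evaluates to
    \<open>(card ?I / n) * (\<Sum>i=1..n. h z (w i)) - sum (h z) ?I\<close>: an empirical mean minus
    its expectation.\<close>
  have dev: "n * (sum (f z) ?I / card ?I) + 2 * \<tau> \<le> (\<Sum>i\<in>?J. f z (w i))"
    if w: "w \<in> ?S" and t: "t / 2 \<le> multilinear_form {1..k} (\<lambda>j. {1..d j}) (X w) z" for w z
  proof -
    have "multilinear_form {1..k} (\<lambda>j. {1..d j}) (X w) z
        = (\<Sum>\<eta>\<in>?I. (1 / n) * (\<Sum>i=1..n. if \<eta> = w i then card ?I * h z \<eta> else 0) - h z \<eta>)"
      unfolding multilinear_form_def tensor_index_def[symmetric] X_def sample_mean_def sampled_tensor_def
        tensor_proj_def prod_d h_def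
      by (intro sum.cong refl) (simp add: algebra_simps sum_distrib_left sum_distrib_right if_distrib cong: if_cong)
    also have "\<dots> = (1 / n) * (\<Sum>i=1..n. \<Sum>\<eta>\<in>?I. if \<eta> = w i then card ?I * h z \<eta> else 0) - sum (h z) ?I"
      by (subst sum.swap) (simp add: sum_subtractf sum_distrib_left)
    also have "(\<Sum>i=1..n. \<Sum>\<eta>\<in>?I. if \<eta> = w i then card ?I * h z \<eta> else 0) = (\<Sum>i=1..n. card ?I * h z (w i))"
      using w finite_I by (intro sum.cong refl) (auto simp: PiE_iff)
    finally have "t / 2 \<le> (card ?I / n) * (\<Sum>i=1..n. h z (w i)) - sum (h z) ?I"
      using t by (simp add: sum_distrib_left)
    then have "(n / (card ?I * (a * rest_scale))) * (t / 2)
       \<le> (n / (card ?I * (a * rest_scale))) * ((card ?I / n) * (\<Sum>i=1..n. h z (w i)) - sum (h z) ?I)"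
      using scale Npos by (intro mult_left_mono) auto
    also have "\<dots> = (\<Sum>i\<in>?J. f z (w i)) - n * (sum (f z) ?I / card ?I)"
    proof -
      have "(m / (N * q)) * ((N / m) * s - H) = s / q - m * (H / q / N)" if "N > 0" "m > 0" "q > 0"
        for N m q s H :: real using that by (simp add: field_simps)
      from this[OF Npos _ scale] show ?thesis
        using \<open>n \<ge> 1\<close> by (simp add: f_def sum_divide_distrib[symmetric])
    qed
    also have "(n / (card ?I * (a * rest_scale))) * (t / 2) = 2 * \<tau>"
      by (simp add: \<tau>_def mult_ac)
    finally show ?thesis by simp
  qed
  have single: "card {w \<in> ?S. w \<notin> overfull \<nu> \<and> n * (sum (f z) ?I / card ?I) + 2 * \<tau> \<le> (\<Sum>i\<in>?J. f z (w i))}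
      \<le> card ?I ^ n * (4 * exp (- \<tau>\<^sup>2 / (8 * \<nu>)))" if z: "z \<in> net" for z
  proof -
    let ?g = "\<lambda>(b, c). (z j1 b)\<^sup>2 * (z j2 c)\<^sup>2"
    have "real (card {w \<in> ?S. w \<notin> overfull \<nu> \<and> card ?J * (sum (f z) ?I / card ?I) + 2 * \<tau> \<le> (\<Sum>i\<in>?J. f z (w i))})
      \<le> card ?I ^ card ?J * (4 * exp (- \<tau>\<^sup>2 / (8 * \<nu>)))"
    proof (rule deviation_off_overfull)
      fix v assume v: "v \<in> ?I"
      have "(f z v)\<^sup>2 = (A v)\<^sup>2 * ((z j1 (v j1))\<^sup>2 * (z j2 (v j2))\<^sup>2) / a\<^sup>2"
        unfolding f_def h_def power_divide power_mult_distrib prod_net_sq[OF z v]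
        using rest_scale_pos by simp
      also have "\<dots> \<le> a\<^sup>2 * ((z j1 (v j1))\<^sup>2 * (z j2 (v j2))\<^sup>2) / a\<^sup>2"
        using A(2)[OF v] A(1) by (intro divide_right_mono mult_right_mono) (auto simp: abs_le_square_iff[symmetric])
      finally show "(f z v)\<^sup>2 \<le> ?g (v j1, v j2)" using A(1) by simp
    next
      have sq: "(\<Sum>i\<in>{1..d j}. (z j i)\<^sup>2) \<le> 1" if "L2_set (z j) {1..d j} \<le> 1" for j
        using that by (simp add: L2_set_def)
      have "sum ?g tensor_cells = (\<Sum>b\<in>{1..d j1}. (z j1 b)\<^sup>2) * (\<Sum>c\<in>{1..d j2}. (z j2 c)\<^sup>2)"
        unfolding tensor_cells_def by (simp add: sum.cartesian_product[symmetric] sum_product)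
      also have "\<dots> \<le> 1" using sq net_entries(1,2)[OF z] by (intro mult_le_one) (auto intro: sum_nonneg)
      finally show "sum ?g tensor_cells \<le> 1" .
    next
      have "real (card (overfull \<nu>)) \<le> card ?I ^ n * (d j1 * d j2 * exp (2 * n / (d j1 * d j2) - \<nu>))"
        using card_overfull_le[of \<nu>] by (simp add: card_tensor_cells)
      also have "\<dots> \<le> card ?I ^ n * (1 / 4)" using \<nu>(2) by (intro mult_left_mono) auto
      finally have "real (4 * card (overfull \<nu>)) \<le> real (card ?I ^ n)" by simp
      then show "4 * card (overfull \<nu>) \<le> card ?I ^ card ?J" by (simp only: of_nat_le_iff card_atLeastAtMost diff_Suc_1)
    qed (use \<nu> \<tau> in \<open>auto simp: card_tensor_cells\<close>)
    then show ?thesis by simp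
  qed
  \<comment> \<open>The overfull event does not depend on \<open>z\<close>, so it is counted once
    and not once per net point.\<close>
  have "{w \<in> ?S. \<exists>z\<in>net. t / 2 \<le> multilinear_form {1..k} (\<lambda>j. {1..d j}) (X w) z}
     \<subseteq> overfull \<nu> \<union> (\<Union>z\<in>net. {w \<in> ?S. w \<notin> overfull \<nu> \<and> n * (sum (f z) ?I / card ?I) + 2 * \<tau> \<le> (\<Sum>i\<in>?J. f z (w i))})"
    (is "?W \<subseteq> _ \<union> (\<Union>z\<in>net. ?V z)")
    using dev by blast
  moreover have "finite ?S" using finite_I by (intro finite_PiE) auto
  ultimately have "card ?W \<le> card (overfull \<nu> \<union> (\<Union>z\<in>net. ?V z))"
    using finite_net by (intro card_mono finite_UnI finite_overfull finite_UN_I) auto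
  also have "\<dots> \<le> card (overfull \<nu>) + card (\<Union>z\<in>net. ?V z)" by (rule card_Un_le)
  also have "\<dots> \<le> card (overfull \<nu>) + (\<Sum>z\<in>net. card (?V z))" by (intro add_left_mono card_UN_le finite_net)
  finally have "real (card ?W) \<le> real (card (overfull \<nu>)) + (\<Sum>z\<in>net. real (card (?V z)))"
    by (simp only: of_nat_le_iff flip: of_nat_add of_nat_sum)
  also have "\<dots> \<le> card ?I ^ n * (d j1 * d j2 * exp (2 * n / (d j1 * d j2) - \<nu>))
      + (\<Sum>z\<in>net. card ?I ^ n * (4 * exp (- \<tau>\<^sup>2 / (8 * \<nu>))))"
    using card_overfull_le[of \<nu>] by (intro add_mono sum_mono single) (simp add: card_tensor_cells)
  also have "(\<Sum>z\<in>net. card ?I ^ n * (4 * exp (- \<tau>\<^sup>2 / (8 * \<nu>)))) = card ?I ^ n * (card net * (4 * exp (- \<tau>\<^sup>2 / (8 * \<nu>))))"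
    by simp
  also have "\<dots> \<le> card ?I ^ n * (48 ^ (\<Sum>j=1..k. d j) * (4 * exp (- \<tau>\<^sup>2 / (8 * \<nu>))))"
    using card_net_le by (intro mult_left_mono mult_right_mono) auto
  finally show ?thesis unfolding X_def by (simp add: ring_distribs)
qed

end

section \<open>Numerical estimates and the tail bound\<close>

lemma finite_mode_pairs: "finite (mode_pairs k)"
  by (rule finite_subset[of _ "{1..k} \<times> {1..k}"]) (auto simp: mode_pairs_def)

text \<open>The increasing pairs and their reversals are disjoint subsets of the square.\<close>

lemma card_mode_pairs_le: "2 * card (mode_pairs k) \<le> k\<^sup>2"
proof -
  have "card (mode_pairs k \<union> prod.swap ` mode_pairs k) = card (mode_pairs k) + card (prod.swap ` mode_pairs k)"
    using finite_mode_pairs by (intro card_Un_disjoint) (auto simp: mode_pairs_def)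
  also have "card (prod.swap ` mode_pairs k) = card (mode_pairs k)" by (intro card_image) simp
  finally have "2 * card (mode_pairs k) = card (mode_pairs k \<union> prod.swap ` mode_pairs k)" by simp
  also have "\<dots> \<le> card ({1..k} \<times> {1..k})" by (intro card_mono) (auto simp: mode_pairs_def)
  finally show ?thesis by (simp add: card_cartesian_product power2_eq_square)
qed

text \<open>The zero tensor is a member. Nonemptiness makes upper bounds for the supremum in the
  norm available.\<close>

lemma incoherent_set_nonempty:
  assumes "k \<ge> 2" "\<And>j. j \<in> {1..k} \<Longrightarrow> d j \<ge> 1" "\<And>j. j \<in> {1..k} \<Longrightarrow> \<delta> j > 0"
  shows "incoherent_set k d \<delta> \<noteq> {}"
proof -
  have "linf_norm (d j) (\<lambda>_. 0) \<le> \<delta> j" if "j \<in> {1..k}" for j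
    using assms(2,3)[OF that] by (simp add: linf_norm_def)
  then have "rank_one_tensor k (\<lambda>_ _. 0) \<in> incoherent_pair_set k d \<delta> (1, 2)"
    unfolding incoherent_pair_set_def by (auto simp: l2_norm_def L2_set_0' intro!: exI[of _ "\<lambda>_ _. 0"])
  moreover have "(1, 2) \<in> mode_pairs k" using assms by (simp add: mode_pairs_def)
  ultimately show ?thesis unfolding incoherent_set_def by blast
qed

text \<open>If all net values were below \<open>t / 2\<close>, every inner product would be at most
  \<open>16/9 * (t / 2) = 8/9 * t\<close>. The gap between \<open>8/9\<close> and 1 makes the
  supremum smaller than \<open>t\<close>, whether or not it is attained.\<close>

lemma incoherent_norm_net:
  assumes "k \<ge> 2" "\<And>j. j \<in> {1..k} \<Longrightarrow> d j \<ge> 1" "\<And>j. j \<in> {1..k} \<Longrightarrow> \<delta> j > 0"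
    and t: "t > 0" "incoherent_norm k d \<delta> X \<ge> t"
  shows "\<exists>(j1, j2)\<in>mode_pairs k. \<exists>z\<in>mode_pair.net k d \<delta> j1 j2.
           t / 2 \<le> multilinear_form {1..k} (\<lambda>j. {1..d j}) X z"
proof (rule ccontr)
  assume neg: "\<not> ?thesis"
  have "tensor_inner k d Y X \<le> 8 / 9 * t" if "Y \<in> incoherent_set k d \<delta>" for Y
  proof -
    obtain p where "p \<in> mode_pairs k" "Y \<in> incoherent_pair_set k d \<delta> p"
      using \<open>Y \<in> incoherent_set k d \<delta>\<close> unfolding incoherent_set_def by blast
    then obtain j1 j2 where p: "(j1, j2) \<in> mode_pairs k" "Y \<in> incoherent_pair_set k d \<delta> (j1, j2)"
      by (cases p) simp
    interpret mode_pair k d \<delta> j1 j2 using assms p by unfold_locales auto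
    obtain z where z: "z \<in> net" "tensor_inner k d Y X \<le> 16 / 9 * multilinear_form {1..k} (\<lambda>j. {1..d j}) X z"
      using incoherent_pair_le_net[OF p(2)] by blast
    then have "multilinear_form {1..k} (\<lambda>j. {1..d j}) X z < t / 2" using neg p(1) z(1) not_le by blast
    then show ?thesis using z(2) by simp
  qed
  then have "incoherent_norm k d \<delta> X \<le> 8 / 9 * t"
    unfolding incoherent_norm_def by (intro cSUP_least incoherent_set_nonempty assms)
  then show False using t by simp
qed

section \<open>Choice of the numerical thresholds\<close>

lemma four_power_ge:
  assumes "k \<ge> 2"
  shows "5 * (k + 1) \<le> (4::nat) ^ k"
  using assms
proof (induction k rule: dec_induct)
  case (step n)
  have "5 * (Suc n + 1) \<le> 4 * (5 * (n + 1))" by simp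
  also have "\<dots> \<le> 4 * 4 ^ n" by (intro mult_left_mono step.IH) simp
  finally show ?case by simp
qed (simp add: numeral_eq_Suc)

text \<open>Here \<open>m\<close> stands for the sum of the \<open>d j\<close>,
  \<open>\<Lambda>\<close> for the logarithm of the number of tensor entries, \<open>L\<close> for
  \<open>ln dm\<close>, \<open>q\<close> for the expected occupancy of a cell and \<open>c\<close>
  for the number of cells. \<open>\<nu>\<close> has to dominate
  \<open>2 * q + \<alpha> * L + ln c\<close>, and \<open>\<tau>^2 / (8 * \<nu>)\<close> the
  logarithm of the net size, of order \<open>m\<close>; in this quotient the factor
  \<open>\<Lambda> * (q + L)\<close> cancels.\<close>

lemma tail_numerics:
  fixes k m :: nat and \<alpha> \<Lambda> L q c \<tau> \<nu> :: real
  assumes k: "k \<ge> 2" and \<alpha>: "\<alpha> > 0" and m: "real m \<ge> k + 1" and L: "L \<ge> 1 / (k + 1)" "L \<le> m"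
    and \<Lambda>: "\<Lambda> \<ge> 2 / 3" and q: "q \<ge> 0" and c: "c \<le> exp \<Lambda>"
    and \<tau>: "\<tau> \<ge> 40 * (3 * \<alpha> + 7) * 2 ^ k * sqrt (m * \<Lambda> * (q + L))"
    and \<nu>_def: "\<nu> = 20 * 4 ^ k * (3 * \<alpha> + 7) * \<Lambda> * (q + L)"
  shows "\<nu> > 0" "c * exp (2 * q - \<nu>) \<le> exp (- \<alpha> * L) / 4" "2 \<le> \<tau>" "4 * q \<le> \<tau>\<^sup>2"
    "48 ^ m * (4 * exp (- \<tau>\<^sup>2 / (8 * \<nu>))) \<le> exp (- \<alpha> * L) / 2"
proof -
  define b where "b = 3 * \<alpha> + 7"
  define F where "F = (4::real) ^ k"
  have b: "b > 7" using \<alpha> by (simp add: b_def)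
  have L0: "L > 0" using L(1) by (rule less_le_trans[rotated]) simp
  have qL: "q + L > 0" using q L0 by simp
  have F5: "F \<ge> 5 * (real k + 1)"
  proof -
    have "real (5 * (k + 1)) \<le> real (4 ^ k)" using four_power_ge[OF k] by (simp only: of_nat_le_iff)
    then show ?thesis by (simp add: F_def)
  qed
  have F15: "F \<ge> 15" using F5 k by simp
  \<comment> \<open>The factor \<open>4 ^ k\<close> compensates for \<open>L\<close> possibly being
    as small as \<open>1 / (k + 1)\<close>.\<close>
  have FL: "F * L \<ge> 5"
  proof -
    have "5 = 5 * (real k + 1) * (1 / (k + 1))" by (simp add: field_simps)
    also have "\<dots> \<le> F * L" by (intro mult_mono) (use F5 F15 L in auto)
    finally show ?thesis .
  qed
  have m0: "real m \<ge> 3" using m k by simp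
  have mL: "real m * L \<ge> 1"
  proof -
    have "1 = (real k + 1) * (1 / (k + 1))" by (simp add: field_simps)
    also have "\<dots> \<le> m * L" by (intro mult_mono) (use m L in auto)
    finally show ?thesis .
  qed
  have \<nu>: "\<nu> = 20 * F * b * \<Lambda> * (q + L)" by (simp add: \<nu>_def F_def b_def)
  show \<nu>_pos: "\<nu> > 0" unfolding \<nu> using F15 b \<Lambda> qL by (intro mult_pos_pos) auto
  have \<tau>0: "\<tau> \<ge> 0"
  proof -
    have "0 \<le> 40 * (3 * \<alpha> + 7) * 2 ^ k * sqrt (m * \<Lambda> * (q + L))" using \<alpha> \<Lambda> qL by simp
    then show ?thesis using \<tau> by linarith
  qed
  have \<tau>2: "\<tau>\<^sup>2 \<ge> 1600 * b\<^sup>2 * F * (m * \<Lambda> * (q + L))"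
  proof -
    have "(2::real) ^ k * 2 ^ k = F" by (simp add: F_def flip: power_mult_distrib)
    then have F2: "((2::real) ^ k)\<^sup>2 = F" by (simp add: power2_eq_square)
    have "0 \<le> m * \<Lambda> * (q + L)" using \<Lambda> qL by simp
    then have "(40 * b * 2 ^ k * sqrt (m * \<Lambda> * (q + L)))\<^sup>2 = 1600 * b\<^sup>2 * F * (m * \<Lambda> * (q + L))"
      by (simp add: power_mult_distrib F2)
    moreover have "(40 * b * 2 ^ k * sqrt (m * \<Lambda> * (q + L)))\<^sup>2 \<le> \<tau>\<^sup>2"
      by (intro power_mono) (use \<tau> \<alpha> \<Lambda> qL in \<open>auto simp: b_def\<close>)
    ultimately show ?thesis by simp
  qed
  have b2: "b\<^sup>2 \<ge> 1" using b by simp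
  have b2F: "b\<^sup>2 * F \<ge> 1 * 15" by (intro mult_mono) (use b2 F15 in auto)
  have \<tau>2': "\<tau>\<^sup>2 \<ge> 16000 * (m * q + m * L)"
  proof -
    have "16000 * (m * q + m * L) = 1600 * 15 * (m * (2 / 3) * (q + L))" by (simp add: algebra_simps)
    also have "\<dots> \<le> 1600 * (b\<^sup>2 * F) * (m * \<Lambda> * (q + L))"
      by (intro mult_mono) (use b2F \<Lambda> qL in auto)
    finally show ?thesis using \<tau>2 by simp
  qed
  have mq: "m * q \<ge> q" using mult_right_mono[of 1 "real m" q] m0 q by simp
  have mq0: "m * q \<ge> 0" using q by simp
  have "4 * q \<le> 4 * (m * q + m * L)" using mq mL by simp
  also have "\<dots> \<le> 16000 * (m * q + m * L)" using mq0 mL by (intro mult_right_mono) auto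
  also note \<tau>2'
  finally show "4 * q \<le> \<tau>\<^sup>2" .
  have "2\<^sup>2 \<le> \<tau>\<^sup>2" using \<tau>2' mq0 mL by simp
  then show "2 \<le> \<tau>" using \<tau>0 by (rule power2_le_imp_le)
  show "c * exp (2 * q - \<nu>) \<le> exp (- \<alpha> * L) / 4"
  proof -
    define W where "W = 20 * F * b * \<Lambda>"
    have "W \<ge> 20 * 15 * b * (2 / 3)" unfolding W_def
      by (intro mult_mono) (use F15 b \<Lambda> in auto)
    then have W: "W \<ge> 200 * b" by simp
    have "2 * q \<le> W * q" using W b q by (intro mult_right_mono) auto
    then have "2 * q - \<nu> \<le> - (W * L)" by (simp add: \<nu> W_def algebra_simps)
    \<comment> \<open>Average of the lower bounds \<open>200 * b * L\<close> and
      \<open>700 * \<Lambda>\<close>: one half pays for \<open>\<alpha> * L\<close>, the other for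
      the number of cells, \<open>c \<le> exp \<Lambda>\<close>, and for the factor
      \<open>1/4\<close>.\<close>
    moreover have "W * L \<ge> 100 * b * L + 350 * \<Lambda>"
    proof -
      have "200 * b * L \<le> W * L" using W L0 by (intro mult_right_mono) auto
      moreover have "700 * \<Lambda> \<le> W * L"
      proof -
        have "700 * \<Lambda> = 20 * (7 * 5) * \<Lambda>" by simp
        also have "\<dots> \<le> 20 * (b * (F * L)) * \<Lambda>"
          by (intro mult_right_mono mult_left_mono mult_mono) (use b FL \<Lambda> in auto)
        finally show ?thesis by (simp add: W_def mult_ac)
      qed
      ultimately show ?thesis by simp
    qed
    moreover have "100 * b * L \<ge> \<alpha> * L" using L0 \<alpha> by (intro mult_right_mono) (auto simp: b_def)
    ultimately have "2 * q - \<nu> \<le> - \<alpha> * L - 350 * \<Lambda>" by simp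
    then have "exp (2 * q - \<nu>) \<le> exp (- \<alpha> * L - 350 * \<Lambda>)" by simp
    then have "c * exp (2 * q - \<nu>) \<le> exp \<Lambda> * exp (- \<alpha> * L - 350 * \<Lambda>)"
      using c by (intro mult_mono) auto
    also have "\<dots> = exp (- \<alpha> * L) * exp (- (349 * \<Lambda>))" by (simp flip: exp_add)
    also have "\<dots> \<le> exp (- \<alpha> * L) * (1 / 4)"
    proof (intro mult_left_mono)
      have "4 \<le> 1 + 349 * \<Lambda>" using \<Lambda> by simp
      also have "\<dots> \<le> exp (349 * \<Lambda>)" by (rule exp_ge_add_one_self)
      finally show "exp (- (349 * \<Lambda>)) \<le> 1 / 4" by (simp add: exp_minus field_simps)
    qed auto
    finally show ?thesis by simp
  qed
  show "48 ^ m * (4 * exp (- \<tau>\<^sup>2 / (8 * \<nu>))) \<le> exp (- \<alpha> * L) / 2"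
  proof -
    have "10 * b * m * (8 * \<nu>) = 1600 * b\<^sup>2 * F * (m * \<Lambda> * (q + L))"
      by (simp add: \<nu> power2_eq_square)
    then have "10 * b * m * (8 * \<nu>) \<le> \<tau>\<^sup>2" using \<tau>2 by linarith
    then have "10 * b * m \<le> \<tau>\<^sup>2 / (8 * \<nu>)"
      using \<nu>_pos by (subst pos_le_divide_eq) auto
    then have 1: "exp (- \<tau>\<^sup>2 / (8 * \<nu>)) \<le> exp (- (10 * b * m))" by simp
    have e1: "exp (1::real) \<ge> 2" using exp_ge_add_one_self[of 1] by simp
    have "(48::real) \<le> 2 ^ 6" by simp
    also have "\<dots> \<le> exp 1 ^ 6" by (intro power_mono e1) auto
    also have "exp 1 ^ 6 = exp (6::real)" by (simp flip: exp_of_nat_mult)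
    finally have "(48::real) ^ m \<le> exp 6 ^ m" by (intro power_mono) auto
    then have 2: "(48::real) ^ m \<le> exp (6 * m)" by (simp add: exp_of_nat2_mult)
    have "(4::real) \<le> 2 ^ 2" by simp
    also have "\<dots> \<le> exp 1 ^ 2" by (intro power_mono e1) auto
    also have "exp 1 ^ 2 = exp (2::real)" by (simp flip: exp_of_nat_mult)
    finally have 3: "(4::real) \<le> exp 2" .
    \<comment> \<open>As \<open>10 * b * m = 30 * \<alpha> * m + 70 * m\<close>, the first summand
      covers \<open>\<alpha> * L\<close> because \<open>L \<le> m\<close>, and the second covers the
      net.\<close>
    have "48 ^ m * (4 * exp (- \<tau>\<^sup>2 / (8 * \<nu>))) \<le> exp (6 * m) * (exp 2 * exp (- (10 * b * m)))"
      by (intro mult_mono 1 2 3) auto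
    also have "\<dots> = exp (6 * m + 2 - 10 * b * m)" by (simp flip: exp_add)
    also have "\<dots> \<le> exp (- \<alpha> * L - 1)"
    proof -
      have "\<alpha> * L \<le> \<alpha> * m" using L \<alpha> by simp
      moreover have "10 * b * m = 30 * (\<alpha> * m) + 70 * m" by (simp add: b_def algebra_simps)
      moreover have "\<alpha> * m \<ge> 0" using \<alpha> by simp
      ultimately show ?thesis using m0 by simp
    qed
    also have "\<dots> = exp (- \<alpha> * L) * exp (- 1)" by (simp flip: exp_add)
    also have "\<dots> \<le> exp (- \<alpha> * L) * (1 / 2)"
      using e1 by (intro mult_left_mono) (auto simp: exp_minus field_simps)
    finally show ?thesis by simp
  qed
qed

text \<open>Translation of the threshold for \<open>t\<close> into the hypotheses of
  \<open>tail_numerics\<close>, followed by \<open>net_deviation\<close>. The overfull event costs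
  \<open>1/4\<close> and the net \<open>1/2\<close> of \<open>exp (- \<alpha> * L)\<close>.\<close>

lemma (in mode_pair) card_net_deviation_le:
  fixes a t \<alpha> \<Lambda> L :: real and n :: nat
  assumes "n \<ge> 1" and \<alpha>: "\<alpha> > 0"
    and A: "a > 0" "\<And>\<eta>. \<eta> \<in> tensor_index k d \<Longrightarrow> \<bar>A \<eta>\<bar> \<le> a"
    and R: "R = (\<Sum>j=1..k. d j)" "R \<ge> k + 1"
    and L: "L \<ge> 1 / (k + 1)" "L \<le> R" and \<Lambda>: "\<Lambda> = ln (card (tensor_index k d))"
    and t: "t \<ge> 160 * (3 * \<alpha> + 7) * sqrt (R * \<Lambda>) / n * 2 ^ k * (\<Prod>j=1..k. \<delta> j) * card (tensor_index k d) * a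
                * sqrt (n / ((\<delta> j1)\<^sup>2 * d j1 * (\<delta> j2)\<^sup>2 * d j2) + L / ((\<delta> j1)\<^sup>2 * (\<delta> j2)\<^sup>2))"
  shows "t > 0"
    "card {w \<in> {1..n} \<rightarrow>\<^sub>E tensor_index k d. \<exists>z\<in>net. t / 2 \<le>
         multilinear_form {1..k} (\<lambda>j. {1..d j}) (\<lambda>\<eta>. sample_mean n (\<lambda>i. sampled_tensor k d A (w i)) \<eta> - A \<eta>) z}
       \<le> card (tensor_index k d) ^ n * exp (- \<alpha> * L)"
proof -
  define N where "N = real (card (tensor_index k d))"
  define q where "q = real n / (d j1 * d j2)"
  define \<tau> where "\<tau> = n * t / (4 * N * a * rest_scale)"
  define \<nu> where "\<nu> = 20 * 4 ^ k * (3 * \<alpha> + 7) * \<Lambda> * (q + L)"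
  have N_prod: "card (tensor_index k d) = (\<Prod>j=1..k. d j)"
    by (simp add: tensor_index_def card_PiE)
  have k: "k \<ge> 2" using pair by (auto simp: mode_pairs_def)
  have dj: "d j1 \<ge> 1" "d j2 \<ge> 1" and \<delta>j: "\<delta> j1 > 0" "\<delta> j2 > 0"
    using d_pos \<delta>_pos pair_mem by auto
  have pair_le: "d j1 * d j2 \<le> card (tensor_index k d)"
  proof -
    have "1 \<le> (\<Prod>j\<in>{1..k} - {j1, j2}. d j)" using d_pos by (intro prod_ge_1) auto
    then show ?thesis unfolding N_prod prod_split_pair by simp
  qed
  \<comment> \<open>As the dimensions sum to more than \<open>k\<close>, some mode has dimension at
    least 2; this keeps \<open>\<Lambda>\<close> above \<open>ln 2\<close>.\<close>
  have N2: "N \<ge> 2"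
  proof -
    have "\<exists>j\<in>{1..k}. d j \<ge> 2"
    proof (rule ccontr)
      assume "\<not> ?thesis"
      then have "d j \<le> 1" if "j \<in> {1..k}" for j using that by force
      then have "(\<Sum>j=1..k. d j) \<le> (\<Sum>j=1..k. 1)" by (intro sum_mono)
      then show False using R by simp
    qed
    then obtain j where j: "j \<in> {1..k}" "d j \<ge> 2" by blast
    have "1 \<le> (\<Prod>i\<in>{1..k} - {j}. d i)" using d_pos by (intro prod_ge_1) auto
    moreover have "(\<Prod>i=1..k. d i) = d j * (\<Prod>i\<in>{1..k} - {j}. d i)" using j by (intro prod.remove) auto
    ultimately have "2 * 1 \<le> (\<Prod>i=1..k. d i)" using j(2) by (metis mult_le_mono)
    then show ?thesis by (simp add: N_def N_prod del: of_nat_prod)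
  qed
  have \<Lambda>': "\<Lambda> \<ge> 2 / 3" "exp \<Lambda> = N"
  proof -
    have "2 / 3 \<le> ln (2::real)" by (rule ln2_ge_two_thirds)
    also have "\<dots> \<le> ln N" using N2 by simp
    finally show "\<Lambda> \<ge> 2 / 3" by (simp add: \<Lambda> N_def)
    show "exp \<Lambda> = N" using N2 by (simp add: \<Lambda> N_def)
  qed
  have L0: "L > 0" using L(1) by (rule less_le_trans[rotated]) simp
  have q0: "q \<ge> 0" by (simp add: q_def)
  have qL: "q + L > 0" using q0 L0 by simp
  \<comment> \<open>The denominators under the square root cancel \<open>\<delta> j1\<close> and
    \<open>\<delta> j2\<close> from the product of all \<open>\<delta> j\<close>, which leaves
    \<open>rest_scale\<close>.\<close>
  define t0 where "t0 = 160 * (3 * \<alpha> + 7) * sqrt (R * \<Lambda>) / n * 2 ^ k * (rest_scale * N * a * sqrt (q + L))"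
  have t_ge: "t \<ge> t0"
  proof -
    have "real n / ((\<delta> j1)\<^sup>2 * d j1 * (\<delta> j2)\<^sup>2 * d j2) + L / ((\<delta> j1)\<^sup>2 * (\<delta> j2)\<^sup>2)
        = (q + L) / (\<delta> j1 * \<delta> j2)\<^sup>2"
      by (simp add: q_def power_mult_distrib add_divide_distrib mult_ac)
    then have "sqrt (n / ((\<delta> j1)\<^sup>2 * d j1 * (\<delta> j2)\<^sup>2 * d j2) + L / ((\<delta> j1)\<^sup>2 * (\<delta> j2)\<^sup>2))
        = sqrt (q + L) / (\<delta> j1 * \<delta> j2)"
      using \<delta>j by (simp add: real_sqrt_divide)
    moreover have "(\<Prod>j=1..k. \<delta> j) = \<delta> j1 * \<delta> j2 * rest_scale"
      unfolding rest_scale_def by (rule prod_split_pair)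
    ultimately show ?thesis using t \<delta>j by (simp add: t0_def N_def mult_ac)
  qed
  have R\<Lambda>: "R * \<Lambda> > 0" using R(2) \<Lambda>'(1) by (intro mult_pos_pos) auto
  have "t0 > 0" unfolding t0_def
    using \<alpha> \<open>n \<ge> 1\<close> R\<Lambda> N2 A(1) rest_scale_pos qL
    by (intro mult_pos_pos divide_pos_pos) auto
  then show "t > 0" using t_ge by simp
  have \<tau>_ge: "\<tau> \<ge> 40 * (3 * \<alpha> + 7) * 2 ^ k * sqrt (R * \<Lambda> * (q + L))"
  proof -
    have "40 * b * w * (x * y) = m * (160 * b * x / m * w * (r * N' * a' * y)) / (4 * N' * a' * r)"
      if "m > 0" "N' > 0" "a' > 0" "r > 0" for b w x y m N' a' r :: real
      using that by (simp add: field_simps)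
    from this[of "real n" N a rest_scale] have
      "40 * (3 * \<alpha> + 7) * 2 ^ k * sqrt (R * \<Lambda> * (q + L)) = n * t0 / (4 * N * a * rest_scale)"
      using \<open>n \<ge> 1\<close> N2 A(1) rest_scale_pos unfolding t0_def real_sqrt_mult[of "R * \<Lambda>"] by simp
    also have "\<dots> \<le> \<tau>" unfolding \<tau>_def
      using t_ge N2 A(1) rest_scale_pos by (intro divide_right_mono mult_left_mono) auto
    finally show ?thesis .
  qed
  have c_le: "real (d j1 * d j2) \<le> exp \<Lambda>" using pair_le by (simp add: \<Lambda>' N_def flip: of_nat_mult)
  have kR: "real R \<ge> k + 1" using R(2) by simp
  note num = tail_numerics[OF k \<alpha> kR L \<Lambda>'(1) q0 c_le \<tau>_ge \<nu>_def]
  have "exp (- \<alpha> * L) \<le> 1" using \<alpha> L0 by simp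
  then have \<nu>_small: "4 * (real (d j1 * d j2) * exp (2 * q - \<nu>)) \<le> 1" using num(2) by linarith
  have "real (card {w \<in> {1..n} \<rightarrow>\<^sub>E tensor_index k d. \<exists>z\<in>net. t / 2 \<le>
         multilinear_form {1..k} (\<lambda>j. {1..d j}) (\<lambda>\<eta>. sample_mean n (\<lambda>i. sampled_tensor k d A (w i)) \<eta> - A \<eta>) z})
       \<le> card (tensor_index k d) ^ n * (d j1 * d j2 * exp (2 * n / (d j1 * d j2) - \<nu>)
               + 48 ^ (\<Sum>j=1..k. d j) * (4 * exp (- \<tau>\<^sup>2 / (8 * \<nu>))))"
    by (rule net_deviation)
      (use \<open>n \<ge> 1\<close> A num(1,3,4) \<nu>_small in \<open>auto simp: \<tau>_def q_def N_def\<close>)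
  also have "\<dots> \<le> card (tensor_index k d) ^ n * (exp (- \<alpha> * L) / 4 + exp (- \<alpha> * L) / 2)"
    using num(2,5) by (intro mult_left_mono add_mono) (auto simp: q_def R(1))
  also have "\<dots> \<le> card (tensor_index k d) ^ n * exp (- \<alpha> * L)"
    by (intro mult_left_mono) auto
  finally show "card {w \<in> {1..n} \<rightarrow>\<^sub>E tensor_index k d. \<exists>z\<in>net. t / 2 \<le>
         multilinear_form {1..k} (\<lambda>j. {1..d j}) (\<lambda>\<eta>. sample_mean n (\<lambda>i. sampled_tensor k d A (w i)) \<eta> - A \<eta>) z}
       \<le> card (tensor_index k d) ^ n * exp (- \<alpha> * L)" .
qed

section \<open>The tail bound: union over all pairs of modes\<close>

theorem theorem2:
  fixes M :: "'w measure"
    and k n :: nat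
    and d :: "nat \<Rightarrow> nat"
    and A :: "(nat \<Rightarrow> nat) \<Rightarrow> real"
    and \<delta> :: "nat \<Rightarrow> real"
    and \<omega> :: "nat \<Rightarrow> 'w \<Rightarrow> nat \<Rightarrow> nat"
    and dm ds \<delta>s \<delta>ss \<alpha> t :: real
    and Xbar :: "'w \<Rightarrow> (nat \<Rightarrow> nat) \<Rightarrow> real"
  assumes "prob_space M"
    and "k \<ge> 2"
    and "n \<ge> 1"
    and "\<forall>j\<in>{1..k}. d j \<ge> 1"
    and "\<forall>j\<in>{1..k}. 0 < \<delta> j \<and> \<delta> j \<le> 1"
    and "iid_uniform M (tensor_index k d) n \<omega>"
    and dm_def: "dm = arith_mean k (\<lambda>j. real (d j))"
    and ds_def: "ds = geom_mean k (\<lambda>j. real (d j))"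
    and \<delta>s_def: "\<delta>s = geom_mean k \<delta>"
    and \<delta>ss_def: "\<delta>ss = min_pair_geom_mean k \<delta>"
    and Xbar_def: "Xbar = (\<lambda>x. sample_mean n (\<lambda>i. sampled_tensor k d A (\<omega> i x)))"
    and "8 * exp 1 / (9 * ln 2) * (real k)^2 * (ln dm)^3 \<le> dm"
    and "\<alpha> > 0"
    and "t \<ge> 160 * (3 * \<alpha> + 7) * (real k / real n) * sqrt (dm * ln ds) * (2 * \<delta>s * ds)^k
              * tensor_max_norm k d A
              * Max ((\<lambda>(j1, j2). sqrt (real n / ((\<delta> j1)^2 * real (d j1) * (\<delta> j2)^2 * real (d j2))
                                        + ln dm / ((\<delta> j1)^2 * (\<delta> j2)^2))) ` mode_pairs k)"
    \<comment> \<open>For \<open>A = 0\<close> and \<open>t = 0\<close> the exponents below are quotients \<open>0 / 0\<close>; only this case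
        is excluded.\<close>
    and "tensor_max_norm k d A \<noteq> 0 \<or> t > 0"
  shows "measure M {x \<in> space M. incoherent_norm k d \<delta> (\<lambda>\<eta>. Xbar x \<eta> - A \<eta>) \<ge> t}
    \<le> 1 / 2 * (real k)^2 * dm powr (- \<alpha>)
      + 1 / (4 * (ln 2)^2) * (real k)^2 * (ln dm)^2
        * (exp (- (9 * real n * t^2
                    / (64 * real k * ds^k * (tensor_max_norm k d A)^2 * ln ds)))
           + exp (- (9 * real n * t
                    / (32 * real k * \<delta>s^k * \<delta>ss powi (-2) * ds^k * tensor_max_norm k d A * ln ds))))"
proof -
  interpret prob_space M by fact
  define I where "I = tensor_index k d"
  define R where "R = (\<Sum>j=1..k. d j)"
  define N where "N = real (card I)"
  define a where "a = tensor_max_norm k d A"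
  define \<Lambda> where "\<Lambda> = ln N"
  define L where "L = ln dm"
  define X where "X = (\<lambda>w \<eta>. sample_mean n (\<lambda>i. sampled_tensor k d A (w i)) \<eta> - A \<eta>)"
  let ?P = "measure M {x \<in> space M. incoherent_norm k d \<delta> (\<lambda>\<eta>. Xbar x \<eta> - A \<eta>) \<ge> t}"
  have k: "k \<ge> 2" and n: "n \<ge> 1" and d_pos: "\<And>j. j \<in> {1..k} \<Longrightarrow> d j \<ge> 1"
    and \<delta>_pos: "\<And>j. j \<in> {1..k} \<Longrightarrow> \<delta> j > 0" and \<alpha>: "\<alpha> > 0"
    using assms by auto
  have fin_I: "finite I" unfolding I_def tensor_index_def by (intro finite_PiE) auto
  have I_ne: "I \<noteq> {}" using d_pos by (auto simp: I_def tensor_index_def PiE_eq_empty_iff)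
  have A_le: "\<bar>A \<eta>\<bar> \<le> a" if "\<eta> \<in> I" for \<eta>
    unfolding a_def tensor_max_norm_def using that fin_I by (intro Max_ge) (auto simp: I_def)
  have dm: "dm = R / k" by (simp add: dm_def arith_mean_def R_def)
  have k_le_R: "k \<le> R"
  proof -
    have "(\<Sum>j=1..k. 1) \<le> R" unfolding R_def using d_pos by (intro sum_mono) auto
    then show ?thesis by simp
  qed
  have dm1: "dm \<ge> 1" unfolding dm using k k_le_R by (simp add: field_simps)
  \<comment> \<open>The probability is bounded by the polynomial term; the nonnegative exponential
    terms are added at the end.\<close>
  have prob_le: "?P \<le> 1 / 2 * (real k)\<^sup>2 * dm powr (- \<alpha>)"
  proof (cases "R = k")
    \<comment> \<open>All dimensions are 1, so \<open>dm = 1\<close> and the right-hand side is at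
      least 2.\<close>
    case True
    then have "dm = 1" using k by (simp add: dm)
    have "(2::real)\<^sup>2 \<le> (real k)\<^sup>2" using k by (intro power_mono) auto
    then have "1 \<le> 1 / 2 * (real k)\<^sup>2 * dm powr (- \<alpha>)" by (simp add: \<open>dm = 1\<close>)
    then show ?thesis using prob_le_1 by (rule order_trans[rotated])
  next
    case False
    then have R: "R \<ge> k + 1" using k_le_R by simp
    \<comment> \<open>The norm vanishes identically while \<open>t\<close> is positive, so the event
      is empty.\<close>
    have A0: "?P \<le> 0" if a0: "a = 0"
    proof -
      have "t > 0" using assms(15) a0 by (simp add: a_def)
      have "A \<eta> = 0" if "\<eta> \<in> I" for \<eta> using A_le[OF that] a0 by simp
      then have "tensor_inner k d Y (X w) = 0" for Y w
        by (auto simp: tensor_inner_def X_def sample_mean_def sampled_tensor_def tensor_proj_def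
            simp flip: I_def intro!: sum.neutral)
      then have "incoherent_norm k d \<delta> (X w) = 0" for w
        unfolding incoherent_norm_def using incoherent_set_nonempty[OF k d_pos \<delta>_pos] by simp
      then have "{x \<in> space M. incoherent_norm k d \<delta> (\<lambda>\<eta>. Xbar x \<eta> - A \<eta>) \<ge> t} = {}"
        using \<open>t > 0\<close> unfolding Xbar_def X_def by (auto simp: not_le)
      then show ?thesis by (simp only: measure_empty order.refl)
    qed
    show ?thesis
    proof (cases "a = 0")
      case True
      show ?thesis by (rule order_trans[OF A0[OF True]]) simp
    next
      case a_ne: False
      have "a \<ge> 0"
      proof -
        obtain \<eta> where "\<eta> \<in> I" using I_ne by blast
        then show ?thesis using A_le[of \<eta>] by linarith
      qed
      then have a: "a > 0" using a_ne by simp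
      have dm_gt: "dm \<ge> (k + 1) / k" unfolding dm using R k by (intro divide_right_mono) auto
      \<comment> \<open>By integrality \<open>dm\<close> is at least \<open>1 + 1 / k\<close>, and
        \<open>ln y \<le> y - 1\<close> is applied to the reciprocal
        \<open>y = k / (k + 1)\<close>.\<close>
      have L_ge: "L \<ge> 1 / (k + 1)"
      proof -
        have "ln (k / (k + 1)) \<le> real k / (k + 1) - 1"
          by (rule ln_le_minus_one) (use k in simp)
        moreover have "ln (k / (k + 1)) = - ln ((k + 1) / k)" using k by (simp add: ln_div)
        moreover have "real k / (k + 1) - 1 = - (1 / (k + 1))" by (simp add: field_simps)
        moreover have "ln ((k + 1) / k) \<le> L"
          unfolding L_def using dm_gt k dm1 by (subst ln_le_cancel_iff) auto
        ultimately show ?thesis by linarith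
      qed
      have L_le: "L \<le> R"
      proof -
        have "L \<le> dm - 1" unfolding L_def using dm1 by (intro ln_le_minus_one) auto
        also have "dm \<le> R" unfolding dm using k divide_left_mono[of 1 "real k" "real R"] by simp
        finally show ?thesis by simp
      qed
      have N_prod: "N = (\<Prod>j=1..k. real (d j))"
        by (simp add: N_def I_def tensor_index_def card_PiE)
      have N_pos: "N > 0" unfolding N_def using fin_I I_ne by (simp add: card_gt_0_iff)
      have ds_pow: "ds ^ k = N" unfolding ds_def geom_mean_def N_prod[symmetric] using k N_pos by simp
      have \<delta>s_pow: "\<delta>s ^ k = (\<Prod>j=1..k. \<delta> j)" unfolding \<delta>s_def geom_mean_def
        using k \<delta>_pos by (intro real_root_pow_pos) (auto intro!: prod_pos)
      have ds_pos: "ds > 0" unfolding ds_def geom_mean_def N_prod[symmetric] using k N_pos by simp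
      have \<Lambda>: "\<Lambda> = k * ln ds" unfolding \<Lambda>_def ds_pow[symmetric] using ds_pos by (simp add: ln_realpow)
      \<comment> \<open>One factor \<open>k\<close> under the root turns the mean dimension
        \<open>dm\<close> into the sum \<open>R\<close>, the other turns \<open>ln ds\<close> into
        \<open>\<Lambda>\<close>.\<close>
      have sqrt_eq: "real k * sqrt (dm * ln ds) = sqrt (R * \<Lambda>)"
      proof -
        have "R * \<Lambda> = (real k)\<^sup>2 * (dm * ln ds)" using k by (simp add: \<Lambda> dm power2_eq_square)
        then show ?thesis by (simp add: real_sqrt_mult)
      qed
      define T where "T = 160 * (3 * \<alpha> + 7) * (real k / real n) * sqrt (dm * ln ds) * (2 * \<delta>s * ds)^k * a"
      let ?r = "\<lambda>(j1, j2). sqrt (real n / ((\<delta> j1)^2 * real (d j1) * (\<delta> j2)^2 * real (d j2))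
                                        + ln dm / ((\<delta> j1)^2 * (\<delta> j2)^2))"
      have "ds \<ge> 1"
      proof -
        have "1 \<le> N" using fin_I I_ne by (simp add: N_def card_gt_0_iff Suc_le_eq)
        then show ?thesis unfolding ds_def geom_mean_def N_prod[symmetric] using k by simp
      qed
      moreover have "\<delta>s \<ge> 0" unfolding \<delta>s_def geom_mean_def
        using \<delta>_pos by (intro real_root_ge_zero prod_nonneg) (simp add: less_imp_le)
      ultimately have T0: "T \<ge> 0" unfolding T_def using \<alpha> dm1 a
        by (intro mult_nonneg_nonneg zero_le_power) auto
      \<comment> \<open>The maximum in the hypothesis on \<open>t\<close> gives every pair of modes
        its own threshold, since \<open>T\<close> is nonnegative.\<close>
      have t_ge: "t \<ge> T * ?r p" if "p \<in> mode_pairs k" for p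
      proof -
        have "?r p \<le> Max (?r ` mode_pairs k)"
          by (intro Max_ge finite_imageI finite_mode_pairs imageI that)
        then have "T * ?r p \<le> T * Max (?r ` mode_pairs k)" by (intro mult_left_mono T0)
        then show ?thesis using assms(14) unfolding T_def a_def by (rule order_trans)
      qed
      let ?S = "{1..n} \<rightarrow>\<^sub>E I"
      let ?V = "\<lambda>(j1, j2). {w \<in> ?S. \<exists>z\<in>mode_pair.net k d \<delta> j1 j2.
        t / 2 \<le> multilinear_form {1..k} (\<lambda>j. {1..d j}) (X w) z}"
      have pair: "t > 0 \<and> card (?V p) \<le> card I ^ n * exp (- \<alpha> * L)" if p: "p \<in> mode_pairs k" for p
      proof -
        obtain j1 j2 where p_eq: "p = (j1, j2)" by (cases p)
        interpret mode_pair k d \<delta> j1 j2 using d_pos \<delta>_pos p p_eq by unfold_locales auto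
        have T_eq: "T = 160 * (3 * \<alpha> + 7) * sqrt (R * \<Lambda>) / n * 2 ^ k * (\<Prod>j=1..k. \<delta> j) * N * a"
          unfolding T_def sqrt_eq[symmetric] power_mult_distrib \<delta>s_pow ds_pow by simp
        have tt: "160 * (3 * \<alpha> + 7) * sqrt (R * \<Lambda>) / n * 2 ^ k * (\<Prod>j=1..k. \<delta> j) * card (tensor_index k d) * a
                * sqrt (n / ((\<delta> j1)\<^sup>2 * d j1 * (\<delta> j2)\<^sup>2 * d j2) + L / ((\<delta> j1)\<^sup>2 * (\<delta> j2)\<^sup>2)) \<le> t"
          using t_ge[OF p] unfolding T_eq p_eq L_def N_def I_def prod.case .
        note dev = card_net_deviation_le[where A = A, OF n \<alpha> a A_le[unfolded I_def] R_def R L_ge L_le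
            \<Lambda>_def[unfolded N_def I_def] tt]
        show ?thesis unfolding p_eq prod.case X_def I_def using dev by (rule conjI)
      qed
      have t: "t > 0"
      proof -
        have "(1, 2) \<in> mode_pairs k" using k by (simp add: mode_pairs_def)
        then show ?thesis by (rule pair[THEN conjunct1])
      qed
      \<comment> \<open>Only the samples with index in \<open>{1..n}\<close> enter, so the event has
        the form required by \<open>prob_iid_uniform\<close>.\<close>
      have norm_cong: "incoherent_norm k d \<delta> (\<lambda>\<eta>. Xbar x \<eta> - A \<eta>)
          = incoherent_norm k d \<delta> (X (\<lambda>i\<in>{1..n}. \<omega> i x))" for x
        unfolding X_def Xbar_def sample_mean_def by simp
      have "?P = card {w \<in> ?S. incoherent_norm k d \<delta> (X w) \<ge> t} / card I ^ n"
        unfolding norm_cong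
        by (rule prob_iid_uniform) (use assms n fin_I I_ne in \<open>auto simp: I_def\<close>)
      also have "\<dots> \<le> (card (mode_pairs k) * (card I ^ n * exp (- \<alpha> * L))) / card I ^ n"
      proof (intro divide_right_mono)
        have "{w \<in> ?S. incoherent_norm k d \<delta> (X w) \<ge> t} \<subseteq> (\<Union>p\<in>mode_pairs k. ?V p)"
        proof
          fix w assume "w \<in> {w \<in> ?S. incoherent_norm k d \<delta> (X w) \<ge> t}"
          then have w: "w \<in> ?S" "incoherent_norm k d \<delta> (X w) \<ge> t" by simp_all
          obtain j1 j2 where "(j1, j2) \<in> mode_pairs k" "\<exists>z\<in>mode_pair.net k d \<delta> j1 j2.
              t / 2 \<le> multilinear_form {1..k} (\<lambda>j. {1..d j}) (X w) z"
            using incoherent_norm_net[OF k d_pos \<delta>_pos t w(2)] by blast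
          with w(1) show "w \<in> (\<Union>p\<in>mode_pairs k. ?V p)" by (intro UN_I[of "(j1, j2)"]) simp_all
        qed
        then have "card {w \<in> ?S. incoherent_norm k d \<delta> (X w) \<ge> t} \<le> card (\<Union>p\<in>mode_pairs k. ?V p)"
          by (intro card_mono finite_UN_I finite_mode_pairs) (use fin_I in \<open>auto intro!: finite_PiE\<close>)
        also have "\<dots> \<le> (\<Sum>p\<in>mode_pairs k. card (?V p))" by (intro card_UN_le finite_mode_pairs)
        finally have "real (card {w \<in> ?S. incoherent_norm k d \<delta> (X w) \<ge> t}) \<le> (\<Sum>p\<in>mode_pairs k. real (card (?V p)))"
          by (simp only: of_nat_le_iff flip: of_nat_sum)
        also have "\<dots> \<le> (\<Sum>p\<in>mode_pairs k. card I ^ n * exp (- \<alpha> * L))"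
          by (intro sum_mono pair[THEN conjunct2])
        finally show "real (card {w \<in> ?S. incoherent_norm k d \<delta> (X w) \<ge> t})
            \<le> card (mode_pairs k) * (card I ^ n * exp (- \<alpha> * L))" by simp
      qed simp
      also have "\<dots> = card (mode_pairs k) * exp (- \<alpha> * L)" using fin_I I_ne by simp
      also have "exp (- \<alpha> * L) = dm powr (- \<alpha>)" using dm1 by (simp add: powr_def L_def)
      also have "card (mode_pairs k) * dm powr (- \<alpha>) \<le> 1 / 2 * (real k)\<^sup>2 * dm powr (- \<alpha>)"
      proof (intro mult_right_mono)
        have "real (2 * card (mode_pairs k)) \<le> real (k\<^sup>2)" using card_mode_pairs_le by (simp only: of_nat_le_iff)
        then show "real (card (mode_pairs k)) \<le> 1 / 2 * (real k)\<^sup>2" by simp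
      qed simp
      finally show ?thesis .
    qed
  qed
  also have "\<dots> \<le> \<dots> + 1 / (4 * (ln 2)^2) * (real k)^2 * (ln dm)^2
        * (exp (- (9 * real n * t^2
                    / (64 * real k * ds^k * (tensor_max_norm k d A)^2 * ln ds)))
           + exp (- (9 * real n * t
                    / (32 * real k * \<delta>s^k * \<delta>ss powi (-2) * ds^k * tensor_max_norm k d A * ln ds))))"
    by (simp add: add_nonneg_nonneg)
  finally show ?thesis .
qed

end
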